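(* Let $\nu>0$ be real. For every fixed nonnegative integer $m$, as $R\to+\infty$ the reproducing kernel $K^{\nu R^2}_{R,m}(z,w)$ of the weighted Bergman-Dirichlet space $\mathcal{A}^{2,\nu R^2}_{R,m}(\mathbb{D}_R)$ (that is, with $\alpha=\nu R^2$) converges, pointwise on $\mathbb{C}\times\mathbb{C}$ and uniformly on compact subsets of $\mathbb{C}\times\mathbb{C}$, to the reproducing kernel $K^{\nu}_m(z,w)$ of the weighted Bargmann-Dirichlet space $\mathcal{B}^{2,\nu}_m(\mathbb{C})$.
   Context: $\mathbb{D}_R=\{z\in\mathbb{C}:|z|<R\}$, $R>0$, and $d\lambda$ is the two-dimensional Lebesgue measure on $\mathbb{C}$. For a power series $f(z)=\sum_{n\ge0}a_nz^n$ and an integer $m\ge0$, write $f_{1,m}(z)=\sum_{n=0}^{m-1}a_nz^n$ (zero if $m=0$) and $f_{2,m}=f-f_{1,m}$; $f^{(m)}$ denotes the $m$-th complex derivative. For $\alpha>-1$, $\mathcal{A}^{2,\alpha}_{R,m}(\mathbb{D}_R)$ (the weighted Bergman-Dirichlet space of order $m$) is the space of all holomorphic $f$ on $\mathbb{D}_R$ with $\|f\|_{\alpha,m,R}^2:=\|f_{1,m}\|_{\alpha,R}^2+\|f_{2,m}^{(m)}\|_{\alpha,R}^2<+\infty$, where $\|g\|_{\alpha,R}^2=\int_{\mathbb{D}_R}|g(z)|^2\left(1-\left|\frac zR\right|^2\right)^{\alpha}d\lambda(z)$, with the associated scalar product. It is a reproducing kernel Hilbert space with kernel denoted $K^{\alpha}_{R,m}(z,w)$,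 $z,w\in\mathbb{D}_R$. For $\nu>0$, $\mathcal{B}^{2,\nu}_m(\mathbb{C})$ (the weighted Bargmann-Dirichlet space of order $m$) is the space of all entire $f$ with $\|f\|_{\nu,m}^2:=\|f_{1,m}\|_\nu^2+\|f_{2,m}^{(m)}\|_\nu^2<+\infty$, where $\|g\|_\nu^2=\int_{\mathbb{C}}|g(z)|^2e^{-\nu|z|^2}d\lambda(z)$, with the associated scalar product. It is a reproducing kernel Hilbert space with kernel denoted $K^\nu_m(z,w)$, $z,w\in\mathbb{C}$. For a given compact subset of $\mathbb{C}\times\mathbb{C}$ (in particular a point), $K^{\nu R^2}_{R,m}$ is defined on it for all sufficiently large $R$, and the limit is understood over such $R$. *)

theory Defs
  imports "HOL-Complex_Analysis.Complex_Analysis"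
begin

section \<open>Weighted scalar products\<close>

text \<open>
  Everything is parametrised by a domain \<open>D\<close> and a weight \<open>\<omega>\<close> on it.  Functions are total, but only
  their values on the open set \<open>D\<close> matter.
\<close>

definition weighted_norm_sq ::
    "complex set \<Rightarrow> (complex \<Rightarrow> real) \<Rightarrow> (complex \<Rightarrow> complex) \<Rightarrow> ennreal" where
  "weighted_norm_sq D \<omega> g = (\<integral>\<^sup>+z\<in>D. ennreal ((cmod (g z))\<^sup>2 * \<omega> z) \<partial>lborel)"

definition weighted_inner ::
    "complex set \<Rightarrow> (complex \<Rightarrow> real) \<Rightarrow> (complex \<Rightarrow> complex) \<Rightarrow> (complex \<Rightarrow> complex) \<Rightarrow> complex" where
  "weighted_inner D \<omega> g h = (LINT z:D|lborel. g z * cnj (h z) * complex_of_real (\<omega> z))"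

section \<open>Dirichlet-type spaces of order \<open>m\<close>\<close>

definition low_part :: "nat \<Rightarrow> (complex \<Rightarrow> complex) \<Rightarrow> complex \<Rightarrow> complex" where
  "low_part m f z = (\<Sum>n<m. fps_nth (fps_expansion f 0) n * z ^ n)"

definition high_part :: "nat \<Rightarrow> (complex \<Rightarrow> complex) \<Rightarrow> complex \<Rightarrow> complex" where
  "high_part m f z = f z - low_part m f z"

definition dirichlet_norm_sq ::
    "complex set \<Rightarrow> (complex \<Rightarrow> real) \<Rightarrow> nat \<Rightarrow> (complex \<Rightarrow> complex) \<Rightarrow> ennreal" where
  "dirichlet_norm_sq D \<omega> m f =
     weighted_norm_sq D \<omega> (low_part m f) + weighted_norm_sq D \<omega> ((deriv ^^ m) (high_part m f))"

definition dirichlet_inner ::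
    "complex set \<Rightarrow> (complex \<Rightarrow> real) \<Rightarrow> nat \<Rightarrow> (complex \<Rightarrow> complex) \<Rightarrow> (complex \<Rightarrow> complex) \<Rightarrow> complex"
  where
  "dirichlet_inner D \<omega> m f g =
     weighted_inner D \<omega> (low_part m f) (low_part m g) +
     weighted_inner D \<omega> ((deriv ^^ m) (high_part m f)) ((deriv ^^ m) (high_part m g))"

definition dirichlet_space ::
    "complex set \<Rightarrow> (complex \<Rightarrow> real) \<Rightarrow> nat \<Rightarrow> (complex \<Rightarrow> complex) set" where
  "dirichlet_space D \<omega> m = {f. f holomorphic_on D \<and> dirichlet_norm_sq D \<omega> m f < \<infinity>}"

section \<open>Reproducing kernels\<close>

text \<open>
  \<open>H\<close> is a space of functions on \<open>D\<close> and \<open>ip\<close> its scalar product, linear in the first argument.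
  The last conjunct of \<open>is_reproducing_kernel\<close> only normalises the (irrelevant) values of the total
  function \<open>K\<close> off \<open>D \<times> D\<close>, so that the kernel is literally unique.
\<close>

definition is_reproducing_kernel ::
    "complex set \<Rightarrow> (complex \<Rightarrow> complex) set \<Rightarrow>
     ((complex \<Rightarrow> complex) \<Rightarrow> (complex \<Rightarrow> complex) \<Rightarrow> complex) \<Rightarrow>
     (complex \<Rightarrow> complex \<Rightarrow> complex) \<Rightarrow> bool" where
  "is_reproducing_kernel D H ip K \<longleftrightarrow>
     (\<forall>w\<in>D. (\<lambda>z. K z w) \<in> H \<and> (\<forall>f\<in>H. f w = ip f (\<lambda>z. K z w))) \<and>
     (\<forall>z w. z \<notin> D \<or> w \<notin> D \<longrightarrow> K z w = 0)"

definition reproducing_kernel ::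
    "complex set \<Rightarrow> (complex \<Rightarrow> complex) set \<Rightarrow>
     ((complex \<Rightarrow> complex) \<Rightarrow> (complex \<Rightarrow> complex) \<Rightarrow> complex) \<Rightarrow>
     complex \<Rightarrow> complex \<Rightarrow> complex" where
  "reproducing_kernel D H ip = (THE K. is_reproducing_kernel D H ip K)"

section \<open>The Bergman-Dirichlet and Bargmann-Dirichlet spaces\<close>

definition bergman_weight :: "real \<Rightarrow> real \<Rightarrow> complex \<Rightarrow> real" where
  "bergman_weight \<alpha> R z = (1 - (cmod (z / complex_of_real R))\<^sup>2) powr \<alpha>"

definition bargmann_weight :: "real \<Rightarrow> complex \<Rightarrow> real" where
  "bargmann_weight \<nu> z = exp (- \<nu> * (cmod z)\<^sup>2)"

definition bergman_dirichlet_space :: "real \<Rightarrow> nat \<Rightarrow> real \<Rightarrow> (complex \<Rightarrow> complex) set" where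
  "bergman_dirichlet_space \<alpha> m R = dirichlet_space (ball 0 R) (bergman_weight \<alpha> R) m"

definition bergman_dirichlet_kernel ::
    "real \<Rightarrow> nat \<Rightarrow> real \<Rightarrow> complex \<Rightarrow> complex \<Rightarrow> complex" where
  "bergman_dirichlet_kernel \<alpha> m R =
     reproducing_kernel (ball 0 R) (bergman_dirichlet_space \<alpha> m R)
       (dirichlet_inner (ball 0 R) (bergman_weight \<alpha> R) m)"

definition bargmann_dirichlet_space :: "real \<Rightarrow> nat \<Rightarrow> (complex \<Rightarrow> complex) set" where
  "bargmann_dirichlet_space \<nu> m = dirichlet_space UNIV (bargmann_weight \<nu>) m"

definition bargmann_dirichlet_kernel ::
    "real \<Rightarrow> nat \<Rightarrow> complex \<Rightarrow> complex \<Rightarrow> complex" where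
  "bargmann_dirichlet_kernel \<nu> m =
     reproducing_kernel UNIV (bargmann_dirichlet_space \<nu> m)
       (dirichlet_inner UNIV (bargmann_weight \<nu>) m)"

end

theory Submission
  imports Defs "HOL-Probability.Sinc_Integral" "HOL-Real_Asymp.Real_Asymp"
begin

text \<open>
  For a radial weight the monomials are orthogonal, so the reproducing kernel of a Dirichlet-type
  space is the power series \<open>\<Sum>n. (z * cnj w) ^ n / c\<^sub>n\<close>, where \<open>c\<^sub>n\<close> is the squared norm of
  \<open>z ^ n\<close> and is given by a moment of the weight.  No closed form of the moments is needed: as
  \<open>R\<close> grows, \<open>(1 - |z|\<^sup>2 / R\<^sup>2) powr (\<nu> * R\<^sup>2)\<close> increases to \<open>exp (- \<nu> * |z|\<^sup>2)\<close>.  Hence the moments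
  converge by dominated convergence, and the series at a fixed radius dominates all later ones on a
  smaller bidisc, so that Tannery's theorem yields uniform convergence there.
\<close>

section \<open>Rotation invariance of the Lebesgue measure\<close>

text \<open>The delicate point is that the explicit series really reproduces. Parseval's identity is
  therefore proved on discs of radius strictly below that of the domain, where the series converge
  absolutely, and both sides are then passed to the limit: dominated convergence for the integral,
  Tannery for the sum. That the kernel sections belong to the space cannot presuppose integrability
  and comes from monotone convergence. Orthogonality of the monomials uses invariance under
  rotations only, which is why that invariance is established first, from Fubini and translations.
  The kernel series converges because the moments grow at least like a constant times r^(2k) for
  every r below the radius of the domain. All coefficients c_n are monotone in the weight, so the
  monotonicity of the weights in R becomes one common majorant for the reciprocals 1/c_n.\<close>

lemma lborel_complex: "lborel = distr (lborel \<Otimes>\<^sub>M lborel) borel (\<lambda>(x, y). Complex x y)"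
proof (rule lborel_eqI)
  have [measurable]: "(\<lambda>(x, y). Complex x y) \<in> borel_measurable (lborel \<Otimes>\<^sub>M lborel)"
    unfolding Complex_eq by measurable
  fix l u :: complex
  assume le: "\<And>b. b \<in> Basis \<Longrightarrow> l \<bullet> b \<le> u \<bullet> b"
  have le': "Re l \<le> Re u" "Im l \<le> Im u"
    using le[of 1] le[of \<i>] by (auto simp: Basis_complex_def)
  have "emeasure (distr (lborel \<Otimes>\<^sub>M lborel) borel (\<lambda>(x, y). Complex x y)) (box l u)
     = emeasure (lborel \<Otimes>\<^sub>M lborel) ({Re l<..<Re u} \<times> {Im l<..<Im u})"
    by (subst emeasure_distr)
       (auto simp: box_def Basis_complex_def space_pair_measure intro!: arg_cong2[where f=emeasure])
  also have "\<dots> = ennreal (Re u - Re l) * ennreal (Im u - Im l)"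
    using le' by (subst lborel.emeasure_pair_measure_Times) auto
  also have "\<dots> = (\<Prod>b\<in>Basis. (u - l) \<bullet> b)"
    using le' by (auto simp: Basis_complex_def ennreal_mult)
  finally show "emeasure (distr (lborel \<Otimes>\<^sub>M lborel) borel (\<lambda>(x, y). Complex x y)) (box l u)
     = (\<Prod>b\<in>Basis. (u - l) \<bullet> b)" .
qed simp

lemma measurable_Complex [measurable]:
  assumes [measurable]: "f \<in> borel_measurable M" "g \<in> borel_measurable M"
  shows "(\<lambda>x. Complex (f x) (g x)) \<in> borel_measurable M"
  unfolding Complex_eq by measurable

lemma measurable_cnj [measurable]:
  assumes "f \<in> borel_measurable M"
  shows "(\<lambda>x. cnj (f x)) \<in> borel_measurable M"
  by (rule measurable_compose[OF assms]) (intro borel_measurable_continuous_onI continuous_intros)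

lemma nn_integral_lborel_complex:
  assumes [measurable]: "f \<in> borel_measurable borel"
  shows "(\<integral>\<^sup>+z. f z \<partial>lborel) = (\<integral>\<^sup>+x. \<integral>\<^sup>+y. f (Complex x y) \<partial>lborel \<partial>lborel)"
    and "(\<integral>\<^sup>+z. f z \<partial>lborel) = (\<integral>\<^sup>+y. \<integral>\<^sup>+x. f (Complex x y) \<partial>lborel \<partial>lborel)"
proof -
  have "(\<integral>\<^sup>+z. f z \<partial>lborel) = (\<integral>\<^sup>+p. f (Complex (fst p) (snd p)) \<partial>(lborel \<Otimes>\<^sub>M lborel))"
    by (subst lborel_complex) (simp add: nn_integral_distr case_prod_beta')
  also have "\<dots> = (\<integral>\<^sup>+x. \<integral>\<^sup>+y. f (Complex x y) \<partial>lborel \<partial>lborel)"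
    by (subst lborel.nn_integral_fst[symmetric]) simp_all
  finally show *: "(\<integral>\<^sup>+z. f z \<partial>lborel) = (\<integral>\<^sup>+x. \<integral>\<^sup>+y. f (Complex x y) \<partial>lborel \<partial>lborel)" .
  show "(\<integral>\<^sup>+z. f z \<partial>lborel) = (\<integral>\<^sup>+y. \<integral>\<^sup>+x. f (Complex x y) \<partial>lborel \<partial>lborel)"
    unfolding * by (rule lborel_pair.Fubini'[symmetric]) simp
qed

text \<open>Reduces invariance of the measure to invariance of nonnegative integrals, where Fubini
  can be used.\<close>

lemma measure_preserving_lborelI:
  fixes T :: "complex \<Rightarrow> complex"
  assumes [measurable]: "T \<in> borel_measurable borel"
    and T: "\<And>f::complex \<Rightarrow> ennreal. f \<in> borel_measurable borel \<Longrightarrow>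
              (\<integral>\<^sup>+z. f (T z) \<partial>lborel) = (\<integral>\<^sup>+z. f z \<partial>lborel)"
  shows "distr lborel borel T = lborel"
proof (rule measure_eqI)
  fix A assume A[measurable]: "A \<in> sets (distr lborel borel T)"
  have "emeasure (distr lborel borel T) A = (\<integral>\<^sup>+z. indicator A (T z) \<partial>lborel)"
    using A by (subst nn_integral_indicator[symmetric, OF A], subst nn_integral_distr) auto
  also have "\<dots> = (\<integral>\<^sup>+z. indicator A z \<partial>lborel)"
    using A by (intro T) simp
  also have "\<dots> = emeasure lborel A"
    using A by simp
  finally show "emeasure (distr lborel borel T) A = emeasure lborel A" .
qed simp

text \<open>On each horizontal line the shear is a translation, which does not change the inner
  integral over \<open>x\<close>; hence the order of integration with \<open>y\<close>
  outside.\<close>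

lemma distr_lborel_shear_Re: "distr lborel borel (\<lambda>z. Complex (Re z + t * Im z) (Im z)) = lborel"
proof (rule measure_preserving_lborelI)
  fix f :: "complex \<Rightarrow> ennreal" assume [measurable]: "f \<in> borel_measurable borel"
  have "(\<integral>\<^sup>+x. f (Complex (x + t * y) y) \<partial>lborel) = (\<integral>\<^sup>+x. f (Complex x y) \<partial>lborel)" for y
    using nn_integral_real_affine[of "\<lambda>x. f (Complex x y)" 1 "t * y"] by (simp add: add.commute)
  then show "(\<integral>\<^sup>+z. f (Complex (Re z + t * Im z) (Im z)) \<partial>lborel) = (\<integral>\<^sup>+z. f z \<partial>lborel)"
    by (subst (1 2) nn_integral_lborel_complex(2)) simp_all
qed simp

lemma distr_lborel_shear_Im: "distr lborel borel (\<lambda>z. Complex (Re z) (Im z + t * Re z)) = lborel"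
proof (rule measure_preserving_lborelI)
  fix f :: "complex \<Rightarrow> ennreal" assume [measurable]: "f \<in> borel_measurable borel"
  have "(\<integral>\<^sup>+y. f (Complex x (y + t * x)) \<partial>lborel) = (\<integral>\<^sup>+y. f (Complex x y) \<partial>lborel)" for x
    using nn_integral_real_affine[of "\<lambda>y. f (Complex x y)" 1 "t * x"] by (simp add: add.commute)
  then show "(\<integral>\<^sup>+z. f (Complex (Re z) (Im z + t * Re z)) \<partial>lborel) = (\<integral>\<^sup>+z. f z \<partial>lborel)"
    by (subst (1 2) nn_integral_lborel_complex(1)) simp_all
qed simp

text \<open>A rotation other than \<open>z \<mapsto> -z\<close> is a product of three shears.\<close>

lemma distr_lborel_rotation:
  fixes c :: complex
  assumes "cmod c = 1"
  shows "distr lborel borel ((*) c) = lborel"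
proof -
  have *: "distr lborel borel ((*) c) = lborel" if c: "cmod c = 1" "c \<noteq> -1" for c
  proof -
    \<comment> \<open>For c = exp(i a) this is -tan(a/2), and the middle shear \<open>T\<close> has
      slope sin a. On the unit circle the denominator vanishes only at -1.\<close>
    define t where "t = - Im c / (1 + Re c)"
    define S where "S = (\<lambda>z. Complex (Re z + t * Im z) (Im z))"
    define T where "T = (\<lambda>z. Complex (Re z) (Im z + Im c * Re z))"
    have sq: "(Re c)\<^sup>2 + (Im c)\<^sup>2 = 1"
      using c(1) by (simp add: cmod_def)
    have ne: "1 + Re c \<noteq> 0"
    proof
      assume *: "1 + Re c = 0"
      then have "Re c = -1" by simp
      then have "Im c = 0" using sq by simp
      then show False using c(2) \<open>Re c = -1\<close> by (simp add: complex_eq_iff)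
    qed
    have "Im c * Im c = (1 + Re c) * (1 - Re c)"
      using sq by (simp add: algebra_simps power2_eq_square)
    then have t: "1 + Im c * t = Re c" "t * (1 + Re c) = - Im c"
      using ne unfolding t_def by (simp_all add: divide_simps)
    have "c * z = S (T (S z))" for z
    proof -
      have "Re z + t * Im z + t * (Im z + Im c * (Re z + t * Im z))
              = (1 + Im c * t) * Re z + t * (1 + (1 + Im c * t)) * Im z"
        by algebra
      moreover have "Im z + Im c * (Re z + t * Im z) = (1 + Im c * t) * Im z + Im c * Re z"
        by algebra
      ultimately show ?thesis
        by (simp add: S_def T_def t complex_eq_iff)
    qed
    then have "(*) c = S \<circ> (T \<circ> S)"
      by auto
    moreover have [measurable]: "S \<in> borel_measurable borel" "T \<in> borel_measurable borel"
      by (simp_all add: S_def T_def)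
    ultimately have "distr lborel borel ((*) c) = distr (distr (distr lborel borel S) borel T) borel S"
      by (simp add: distr_distr comp_assoc)
    then show ?thesis
      by (simp add: S_def T_def distr_lborel_shear_Re distr_lborel_shear_Im)
  qed
  show ?thesis
  proof (cases "c = -1")
    case True
    \<comment> \<open>The half turn is two quarter turns, each of which the three shears
      cover.\<close>
    have "distr lborel borel ((*) c) = distr (distr lborel borel ((*) \<i>)) borel ((*) \<i>)"
      by (subst distr_distr) (auto simp: True o_def mult.assoc[symmetric] intro!: distr_cong)
    moreover have "\<i> \<noteq> -1" by (simp add: complex_eq_iff)
    ultimately show ?thesis by (simp add: *)
  qed (use assms * in simp)
qed

lemma integral_lborel_rotation:
  fixes f :: "complex \<Rightarrow> complex"
  assumes "cmod c = 1" "f \<in> borel_measurable borel"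
  shows "(\<integral>z. f (c * z) \<partial>lborel) = (\<integral>z. f z \<partial>lborel)"
  using assms by (subst (2) distr_lborel_rotation[OF assms(1), symmetric]) (simp add: integral_distr)

section \<open>Polynomial moments of the Gaussian\<close>

text \<open>A constant multiple of \<open>g (Re z) * g (Im z)\<close> dominates the integrand, and
  its integral splits by Fubini into two convergent real integrals.\<close>

lemma integrable_power_mult_gaussian:
  assumes "\<nu> > 0"
  shows "integrable lborel (\<lambda>z::complex. cmod z ^ k * exp (- \<nu> * (cmod z)\<^sup>2))"
proof -
  define g where "g = (\<lambda>x::real. inverse (1 + x\<^sup>2))"
  have g0: "g x \<ge> 0" for x by (simp add: g_def add_nonneg_nonneg)
  have gi: "integrable lborel g"
    using integrable_inverse_1_plus_square by (simp add: g_def set_integrable_def)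
  \<comment> \<open>Since (1 + x^2)(1 + y^2) is at most (1 + |z|^2)^2, the domination follows once
    \<open>h\<close> is bounded above on r >= 0; this holds by its limit at infinity and compactness
    of the remaining interval.\<close>
  define h where "h = (\<lambda>r::real. r ^ k * (1 + r\<^sup>2)\<^sup>2 * exp (- \<nu> * r\<^sup>2))"
  have "(h \<longlongrightarrow> 0) at_top"
    unfolding h_def using assms by real_asymp
  then have "\<forall>\<^sub>F r in at_top. h r < 1"
    by (rule order_tendstoD) simp
  then obtain r0 where r0: "\<And>r. r \<ge> r0 \<Longrightarrow> h r < 1"
    by (auto simp: eventually_at_top_linorder)
  have "compact (h ` {0..r0})"
    unfolding h_def by (intro compact_continuous_image continuous_intros) auto
  then have "bounded (h ` {0..r0})"
    by (rule compact_imp_bounded)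
  then obtain B0 where B0: "\<And>r. r \<in> {0..r0} \<Longrightarrow> \<bar>h r\<bar> \<le> B0"
    unfolding bounded_iff real_norm_def by (meson imageI)
  define B where "B = max 1 B0"
  have B: "h r \<le> B" if "r \<ge> 0" for r
    using r0[of r] B0[of r] that unfolding B_def by (cases "r \<ge> r0") auto
  have "integrable lborel (\<lambda>z. B * (g (Re z) * g (Im z)))"
  proof -
    have "(\<integral>\<^sup>+z. ennreal (g (Re z) * g (Im z)) \<partial>lborel) = (\<integral>\<^sup>+x. ennreal (g x) \<partial>lborel) * (\<integral>\<^sup>+x. ennreal (g x) \<partial>lborel)"
      using g0 by (subst nn_integral_lborel_complex(1))
        (auto simp: ennreal_mult nn_integral_cmult nn_integral_multc g_def)
    also have "\<dots> < \<infinity>"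
      using gi g0 by (simp add: integrable_iff_bounded ennreal_mult_less_top abs_of_nonneg)
    finally have "integrable lborel (\<lambda>z. g (Re z) * g (Im z))"
      using g0 by (intro integrableI_bounded) (simp_all add: g_def)
    then show ?thesis by simp
  qed
  then show ?thesis
  proof (rule Bochner_Integration.integrable_bound)
    show "AE z in lborel. norm (cmod z ^ k * exp (- \<nu> * (cmod z)\<^sup>2)) \<le> norm (B * (g (Re z) * g (Im z)))"
    proof (rule AE_I2)
      fix z
      have p: "(1 + (Re z)\<^sup>2) * (1 + (Im z)\<^sup>2) > 0"
        by (intro mult_pos_pos add_pos_nonneg) auto
      have "(1 + (Re z)\<^sup>2) * (1 + (Im z)\<^sup>2) \<le> (1 + (cmod z)\<^sup>2)\<^sup>2"
        unfolding power2_eq_square[of "1 + _"] by (intro mult_mono) (auto simp: cmod_power2)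
      then have "cmod z ^ k * exp (- \<nu> * (cmod z)\<^sup>2) * ((1 + (Re z)\<^sup>2) * (1 + (Im z)\<^sup>2))
              \<le> cmod z ^ k * exp (- \<nu> * (cmod z)\<^sup>2) * (1 + (cmod z)\<^sup>2)\<^sup>2"
        by (intro mult_left_mono) auto
      also have "\<dots> \<le> B" using B[of "cmod z"] by (simp add: h_def mult_ac)
      finally have "cmod z ^ k * exp (- \<nu> * (cmod z)\<^sup>2) \<le> B * (g (Re z) * g (Im z))"
        using p by (simp add: g_def field_simps)
      then show "norm (cmod z ^ k * exp (- \<nu> * (cmod z)\<^sup>2)) \<le> norm (B * (g (Re z) * g (Im z)))"
        by simp
    qed
  qed simp
qed

section \<open>Radial weights\<close>

text \<open>The squared weighted norm of \<open>z ^ k\<close>, hence the even exponent.\<close>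

definition moment :: "(complex \<Rightarrow> real) \<Rightarrow> nat \<Rightarrow> real" where
  "moment u k = (\<integral>z. cmod z ^ (2 * k) * u z \<partial>lborel)"

text \<open>The weight lives on the whole plane; a domain is encoded by letting \<open>u\<close>
  vanish off it, so that every integral is over \<open>lborel\<close>. Odd powers are included
  because \<open>z ^ j * cnj (z ^ k)\<close> has modulus \<open>cmod z ^ (j + k)\<close>.\<close>

locale radial_weight =
  fixes u :: "complex \<Rightarrow> real"
  assumes weight_measurable [measurable]: "u \<in> borel_measurable borel"
    and weight_nonneg: "u z \<ge> 0"
    and weight_rotation: "cmod c = 1 \<Longrightarrow> u (c * z) = u z"
    and moments_integrable: "integrable lborel (\<lambda>z. cmod z ^ k * u z)"
begin

lemma moment_nonneg: "moment u k \<ge> 0"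
  unfolding moment_def by (intro integral_nonneg_AE) (simp add: weight_nonneg)

lemma integrable_bounded_by_power:
  fixes h :: "complex \<Rightarrow> complex"
  assumes [measurable]: "h \<in> borel_measurable borel" and "\<And>z. cmod (h z) \<le> C * cmod z ^ k"
  shows "integrable lborel (\<lambda>z. h z * of_real (u z))"
proof (rule Bochner_Integration.integrable_bound)
  show "integrable lborel (\<lambda>z. C * (cmod z ^ k * u z))"
    using moments_integrable by simp
  show "AE z in lborel. norm (h z * of_real (u z)) \<le> norm (C * (cmod z ^ k * u z))"
  proof (rule AE_I2)
    fix z
    have "cmod (h z) * u z \<le> C * cmod z ^ k * u z"
      by (intro mult_right_mono assms(2) weight_nonneg)
    then show "norm (h z * of_real (u z)) \<le> norm (C * (cmod z ^ k * u z))"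
      by (simp add: norm_mult weight_nonneg mult.assoc del: abs_mult)
  qed
qed simp

lemma monomials_orthogonal:
  "(\<integral>z. z ^ j * cnj (z ^ k) * of_real (u z) \<partial>lborel) = (if j = k then of_real (moment u k) else 0)"
proof (cases "j = k")
  case True
  have "z ^ k * cnj (z ^ k) = complex_of_real (cmod z ^ (2 * k))" for z
    using complex_norm_square[of "z ^ k"] by (simp add: norm_power power_mult[symmetric] mult.commute)
  then have "(\<integral>z. z ^ j * cnj (z ^ k) * of_real (u z) \<partial>lborel)
          = (\<integral>z. complex_of_real (cmod z ^ (2 * k) * u z) \<partial>lborel)"
    by (intro Bochner_Integration.integral_cong)
       (simp_all only: True of_real_mult)
  then show ?thesis
    by (simp add: True moment_def del: of_real_mult)
next
  case False
  \<comment> \<open>Rotating by \<open>c\<close> multiplies the integral by c^(j-k). This angle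
    makes the factor \<open>cis 1\<close>, which differs from 1 because sin 1 > 0.\<close>
  define c where "c = cis (1 / (real j - real k))"
  have norm_c: "cmod c = 1"
    by (simp add: c_def)
  have rot: "u (c * z) = u z" for z
    by (rule weight_rotation[OF norm_c])
  let ?I = "\<integral>z. z ^ j * cnj (z ^ k) * of_real (u z) \<partial>lborel"
  have "?I = (\<integral>z. (c * z) ^ j * cnj ((c * z) ^ k) * of_real (u (c * z)) \<partial>lborel)"
    by (subst integral_lborel_rotation) (auto simp: norm_c)
  also have "\<dots> = (\<integral>z. (c ^ j * cnj c ^ k) * (z ^ j * cnj (z ^ k) * of_real (u z)) \<partial>lborel)"
    by (intro Bochner_Integration.integral_cong)
       (simp_all only: rot, simp_all only: power_mult_distrib complex_cnj_mult complex_cnj_power mult_ac)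
  also have "\<dots> = (c ^ j * cnj c ^ k) * ?I"
    by (rule integral_mult_right_zero)
  also have "c ^ j * cnj c ^ k = cis ((real j - real k) / (real j - real k))"
    by (simp add: c_def Complex.DeMoivre cis_mult cis_cnj flip: diff_divide_distrib)
  also have "\<dots> = cis 1"
    using False by simp
  finally have "(1 - cis 1) * ?I = 0"
    by (simp add: algebra_simps)
  moreover have "cis 1 \<noteq> 1"
    using sin_gt_zero_02[of 1] by (auto simp: complex_eq_iff)
  ultimately show ?thesis
    using False by simp
qed

text \<open>On the support of \<open>u\<close> the k-th term is at most
  \<open>cmod (A k) * r ^ k * (M * u z)\<close>, which is summable in k and integrable in z, so sum
  and integral may be interchanged.\<close>

lemma power_series_term_integration:
  fixes A :: "nat \<Rightarrow> complex" and h :: "complex \<Rightarrow> complex"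
  assumes supp: "\<And>z. cmod z > r \<Longrightarrow> u z = 0" and r: "r \<ge> 0"
    and A: "summable (\<lambda>k. cmod (A k) * r ^ k)"
    and [measurable]: "h \<in> borel_measurable borel"
    and h: "\<And>z. u z \<noteq> 0 \<Longrightarrow> cmod (h z) \<le> M"
  shows "(\<lambda>k. A k * (\<integral>z. z ^ k * h z * of_real (u z) \<partial>lborel)) sums
           (\<integral>z. (\<Sum>k. A k * z ^ k) * h z * of_real (u z) \<partial>lborel)"
    and "integrable lborel (\<lambda>z. (\<Sum>k. A k * z ^ k) * h z * of_real (u z))"
proof -
  define f where "f k z = A k * (z ^ k * h z * of_real (u z))" for k z
  have [measurable]: "f k \<in> borel_measurable borel" for k
    unfolding f_def by measurable
  have *: "cmod (f k z) \<le> cmod (A k) * r ^ k * (M * u z)" for k z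
  proof (cases "u z = 0")
    case False
    then have "cmod z \<le> r" "cmod (h z) \<le> M"
      using supp[of z] h[of z] by (auto simp: not_le[symmetric])
    then have "cmod (z ^ k) * cmod (h z) \<le> r ^ k * M"
      using r by (intro mult_mono) (auto simp: norm_power power_mono)
    then have "cmod (A k) * (cmod (z ^ k) * cmod (h z)) * u z \<le> cmod (A k) * (r ^ k * M) * u z"
      by (intro mult_right_mono mult_left_mono weight_nonneg) auto
    then show ?thesis
      by (simp add: f_def norm_mult mult_ac abs_of_nonneg weight_nonneg)
  qed (simp add: f_def)
  have u: "integrable lborel u"
    using moments_integrable[of 0] by simp
  have int: "integrable lborel (f k)" for k
  proof (rule Bochner_Integration.integrable_bound)
    show "integrable lborel (\<lambda>z. cmod (A k) * r ^ k * (M * u z))"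
      using u by simp
    show "AE z in lborel. norm (f k z) \<le> norm (cmod (A k) * r ^ k * (M * u z))"
      by (intro AE_I2 order_trans[OF *]) simp
  qed simp
  have sum: "summable (\<lambda>k. cmod (f k z))" for z
    using * by (intro summable_comparison_test'[OF summable_mult2[OF A], of 0 _ "M * u z"]) simp
  have sumI: "summable (\<lambda>k. \<integral>z. cmod (f k z) \<partial>lborel)"
  proof (rule summable_comparison_test'[OF summable_mult2[OF A]])
    fix k
    have "(\<integral>z. cmod (f k z) \<partial>lborel) \<le> (\<integral>z. cmod (A k) * r ^ k * (M * u z) \<partial>lborel)"
      using int u * by (intro integral_mono integrable_norm) auto
    then show "norm (\<integral>z. cmod (f k z) \<partial>lborel) \<le> cmod (A k) * r ^ k * (M * (\<integral>z. u z \<partial>lborel))"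
      by simp
  qed
  \<comment> \<open>Beyond radius \<open>r\<close> the power series may diverge and its
    \<open>suminf\<close> carries no information; there both sides vanish with
    \<open>u z\<close>.\<close>
  have eq: "(\<Sum>k. f k z) = (\<Sum>k. A k * z ^ k) * h z * of_real (u z)" for z
  proof (cases "u z = 0")
    case False
    then have "cmod z \<le> r"
      using supp[of z] by (auto simp: not_le[symmetric])
    then have "summable (\<lambda>k. cmod (A k * z ^ k))"
      by (intro summable_comparison_test'[OF A, of 0])
         (auto simp: norm_mult norm_power intro!: mult_left_mono power_mono)
    then have "summable (\<lambda>k. A k * z ^ k)"
      by (rule summable_norm_cancel)
    from suminf_mult2[OF this, of "h z * of_real (u z)"] show ?thesis
      by (simp add: f_def mult_ac)
  qed (simp add: f_def)
  show "integrable lborel (\<lambda>z. (\<Sum>k. A k * z ^ k) * h z * of_real (u z))"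
    using integrable_suminf[OF int _ sumI] sum eq by simp
  have "(\<lambda>k. \<integral>z. f k z \<partial>lborel) sums (\<integral>z. (\<Sum>k. f k z) \<partial>lborel)"
    by (intro sums_integral int sumI) (simp add: sum)
  then show "(\<lambda>k. A k * (\<integral>z. z ^ k * h z * of_real (u z) \<partial>lborel)) sums
           (\<integral>z. (\<Sum>k. A k * z ^ k) * h z * of_real (u z) \<partial>lborel)"
    by (simp add: eq) (simp add: f_def)
qed

text \<open>Termwise integration is applied twice: integrating \<open>G\<close> against a monomial
  isolates one coefficient by orthogonality, and then the first series is integrated against
  \<open>cnj (G z)\<close>, which is bounded on the support.\<close>

lemma parseval_bounded_support:
  fixes A B :: "nat \<Rightarrow> complex"
  assumes supp: "\<And>z. cmod z > r \<Longrightarrow> u z = 0" and r: "r \<ge> 0"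
    and A: "summable (\<lambda>k. cmod (A k) * r ^ k)"
    and B: "summable (\<lambda>k. cmod (B k) * r ^ k)"
  shows "(\<lambda>k. A k * cnj (B k) * of_real (moment u k)) sums
           (\<integral>z. (\<Sum>k. A k * z ^ k) * cnj (\<Sum>k. B k * z ^ k) * of_real (u z) \<partial>lborel)" (is "_ sums ?I")
    and "integrable lborel (\<lambda>z. (\<Sum>k. A k * z ^ k) * cnj (\<Sum>k. B k * z ^ k) * of_real (u z))"
proof -
  define G where "G z = (\<Sum>k. B k * z ^ k)" for z
  have [measurable]: "G \<in> borel_measurable borel"
    unfolding G_def by measurable
  have r': "cmod z \<le> r" if "u z \<noteq> 0" for z
    using supp[of z] that by (auto simp: not_le[symmetric])
  have G: "cmod (G z) \<le> (\<Sum>k. cmod (B k) * r ^ k)" if "u z \<noteq> 0" for z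
    unfolding G_def using r'[OF that]
    by (intro norm_suminf_le B) (auto simp: norm_mult norm_power intro!: mult_left_mono power_mono)
  have "(\<integral>z. z ^ l * cnj (G z) * of_real (u z) \<partial>lborel) = cnj (B l) * of_real (moment u l)" for l
  proof -
    have "(\<lambda>k. B k * (\<integral>z. z ^ k * cnj (z ^ l) * of_real (u z) \<partial>lborel)) sums
            (\<integral>z. G z * cnj (z ^ l) * of_real (u z) \<partial>lborel)"
      unfolding G_def using r'
      by (intro power_series_term_integration(1)[OF supp r B, where M = "r ^ l"])
         (auto simp: norm_power intro!: power_mono)
    moreover have "(\<lambda>k. B k * (if k = l then of_real (moment u l) else 0)) sums (B l * of_real (moment u l))"
      using sums_single[of l "\<lambda>k. B k * of_real (moment u l)"] by (simp add: if_distrib cong: if_cong)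
    ultimately have "(\<integral>z. G z * cnj (z ^ l) * of_real (u z) \<partial>lborel) = B l * of_real (moment u l)"
      unfolding monomials_orthogonal by (rule sums_unique2)
    then have *: "cnj (\<integral>z. G z * cnj (z ^ l) * of_real (u z) \<partial>lborel) = cnj (B l) * of_real (moment u l)"
      by simp
    have "(\<integral>z. z ^ l * cnj (G z) * of_real (u z) \<partial>lborel)
            = (\<integral>z. cnj (G z * cnj (z ^ l) * of_real (u z)) \<partial>lborel)"
      by (intro Bochner_Integration.integral_cong) (simp_all add: mult_ac)
    then show ?thesis
      unfolding Bochner_Integration.integral_cnj * .
  qed
  with power_series_term_integration(1)[OF supp r A, of "\<lambda>z. cnj (G z)" "\<Sum>k. cmod (B k) * r ^ k"] G
  have "(\<lambda>k. A k * (cnj (B k) * of_real (moment u k))) sums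
          (\<integral>z. (\<Sum>k. A k * z ^ k) * cnj (G z) * of_real (u z) \<partial>lborel)"
    by simp
  then show "(\<lambda>k. A k * cnj (B k) * of_real (moment u k)) sums ?I"
    by (simp add: G_def mult_ac)
  show "integrable lborel (\<lambda>z. (\<Sum>k. A k * z ^ k) * cnj (\<Sum>k. B k * z ^ k) * of_real (u z))"
    using power_series_term_integration(2)[OF supp r A, of "\<lambda>z. cnj (G z)" "\<Sum>k. cmod (B k) * r ^ k"] G
    by (simp add: G_def)
qed

text \<open>Truncation gives bounded support, so that \<open>parseval_bounded_support\<close>
  becomes applicable.\<close>

lemma radial_weight_ball: "radial_weight (\<lambda>z. indicator (ball 0 r) z * u z)"
proof
  show "integrable lborel (\<lambda>z. cmod z ^ k * (indicator (ball 0 r) z * u z))" for k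
    using moments_integrable[of k]
    by (rule Bochner_Integration.integrable_bound) (auto simp: indicator_def)
qed (auto simp: weight_nonneg weight_rotation norm_mult indicator_def)

end

section \<open>Power series expansions\<close>

lemma low_part_has_fps_expansion:
  "low_part m f has_fps_expansion (\<Sum>n<m. fps_const (fps_nth (fps_expansion f 0) n) * fps_X ^ n)"
proof -
  have "(\<lambda>z. \<Sum>n<m. fps_nth (fps_expansion f 0) n * z ^ n) has_fps_expansion
          (\<Sum>n<m. fps_const (fps_nth (fps_expansion f 0) n) * fps_X ^ n)"
    by (intro fps_expansion_intros)
  then show ?thesis
    by (simp add: low_part_def[abs_def])
qed

lemma power_series_expansion_sums:
  assumes "f holomorphic_on eball 0 \<rho>" "z \<in> eball 0 \<rho>"
  shows "(\<lambda>n. fps_nth (fps_expansion f 0) n * z ^ n) sums f z"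
proof -
  have "ereal (cmod z) < \<rho>" using assms(2) by simp
  then have "0 < \<rho>" by (rule le_less_trans[rotated]) simp
  then show ?thesis
    using assms by (intro has_fps_expansion_imp_sums_complex[OF _ assms(1)])
      (auto simp: zero_ereal_def intro!: has_fps_expansion_fps_expansion[of "eball 0 \<rho>"])
qed

lemma power_series_expansion_abs_summable:
  assumes "f holomorphic_on eball 0 \<rho>" "r \<ge> 0" "ereal r < \<rho>"
  shows "summable (\<lambda>n. cmod (fps_nth (fps_expansion f 0) n) * r ^ n)"
proof -
  have "ereal (norm (complex_of_real r)) < fps_conv_radius (fps_expansion f 0)"
    using conv_radius_fps_expansion[OF assms(1)] assms(2,3) by (simp add: order.strict_trans2)
  from norm_summable_fps[OF this] show ?thesis
    using assms(2) by (simp add: norm_mult norm_power)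
qed

text \<open>Removing the low part leaves the coefficients from index \<open>m\<close> on untouched,
  and the k-th derivative at 0 of an m-th derivative is the (k+m)-th derivative.\<close>

lemma high_part_deriv:
  assumes "f holomorphic_on eball 0 \<rho>" "\<rho> > 0"
  shows "(deriv ^^ m) (high_part m f) holomorphic_on eball 0 \<rho>"
    and "fps_nth (fps_expansion ((deriv ^^ m) (high_part m f)) 0) k
           = fact (k + m) / fact k * fps_nth (fps_expansion f 0) (k + m)"
proof -
  have "low_part m f holomorphic_on eball 0 \<rho>"
    unfolding low_part_def[abs_def] by (intro holomorphic_intros)
  then have "high_part m f holomorphic_on eball 0 \<rho>"
    unfolding high_part_def[abs_def] using assms(1) by (intro holomorphic_intros)
  then show "(deriv ^^ m) (high_part m f) holomorphic_on eball 0 \<rho>"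
    by (rule holomorphic_higher_deriv) simp
  define G where "G = fps_expansion f 0 - (\<Sum>n<m. fps_const (fps_nth (fps_expansion f 0) n) * fps_X ^ n)"
  have "f has_fps_expansion fps_expansion f 0"
    using assms by (intro has_fps_expansion_fps_expansion[of "eball 0 \<rho>"]) (auto simp: zero_ereal_def)
  then have "high_part m f has_fps_expansion G"
    unfolding high_part_def[abs_def] G_def by (intro fps_expansion_intros low_part_has_fps_expansion)
  then have "fps_nth G (k + m) = (deriv ^^ (k + m)) (high_part m f) 0 / fact (k + m)"
    by (rule fps_nth_fps_expansion)
  moreover have "fps_nth G (k + m) = fps_nth (fps_expansion f 0) (k + m)"
    by (simp add: G_def fps_sum_nth fps_X_power_mult_right_nth)
  ultimately show "fps_nth (fps_expansion ((deriv ^^ m) (high_part m f)) 0) k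
           = fact (k + m) / fact k * fps_nth (fps_expansion f 0) (k + m)"
    by (simp add: fps_expansion_def funpow_add)
qed

text \<open>The converse direction, for functions given by their coefficients; it is applied to the
  kernel sections. \<open>g\<close> may be arbitrary off the disc.\<close>

lemma holomorphic_on_eball_power_series:
  fixes b :: "nat \<Rightarrow> complex"
  assumes "\<rho> > 0" and b: "\<And>r. r \<ge> 0 \<Longrightarrow> ereal r < \<rho> \<Longrightarrow> summable (\<lambda>n. cmod (b n) * r ^ n)"
    and g: "\<And>z. z \<in> eball 0 \<rho> \<Longrightarrow> g z = (\<Sum>n. b n * z ^ n)"
  shows "g holomorphic_on eball 0 \<rho>" and "fps_nth (fps_expansion g 0) n = b n"
proof -
  have rad: "fps_conv_radius (Abs_fps b) \<ge> \<rho>"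
    unfolding fps_conv_radius_def
  proof (rule conv_radius_geI_ex')
    fix r :: real assume "0 < r" "ereal r < \<rho>"
    then have "summable (\<lambda>n. cmod (fps_nth (Abs_fps b) n * of_real r ^ n))"
      using b[of r] by (simp add: norm_mult norm_power)
    then show "summable (\<lambda>n. fps_nth (Abs_fps b) n * of_real r ^ n)"
      by (rule summable_norm_cancel)
  qed
  have eq: "g z = eval_fps (Abs_fps b) z" if "z \<in> eball 0 \<rho>" for z
    using g[OF that] by (simp add: eval_fps_def)
  have "eval_fps (Abs_fps b) holomorphic_on eball 0 \<rho>"
    using rad by (intro holomorphic_on_eval_fps) (auto intro: order.strict_trans2)
  then show "g holomorphic_on eball 0 \<rho>"
    by (rule holomorphic_transform) (simp add: eq)
  have "eval_fps (Abs_fps b) has_fps_expansion Abs_fps b"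
    using \<open>\<rho> > 0\<close> rad by (intro eval_fps_has_fps_expansion) (auto intro: order.strict_trans2)
  moreover have "eventually (\<lambda>z. g z = eval_fps (Abs_fps b) z) (nhds 0)"
    using eq \<open>\<rho> > 0\<close> by (intro eventually_nhds_in_open[of "eball 0 \<rho>", THEN eventually_mono]) (auto simp: zero_ereal_def)
  ultimately have "g has_fps_expansion Abs_fps b"
    by (simp add: has_fps_expansion_cong)
  then have "fps_expansion g 0 = Abs_fps b"
    by (rule fps_expansion_eqI)
  then show "fps_nth (fps_expansion g 0) n = b n"
    by simp
qed

section \<open>Reproducing kernels of Dirichlet-type spaces\<close>

text \<open>Moves the domain into the weight, where the results on radial weights apply.\<close>

lemma weighted_inner_eq:
  "weighted_inner D \<omega> g h = (\<integral>z. g z * cnj (h z) * of_real (indicator D z * \<omega> z) \<partial>lborel)"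
  unfolding weighted_inner_def set_lebesgue_integral_def
  by (intro Bochner_Integration.integral_cong) (auto simp: indicator_def)

lemma weighted_norm_sq_eq:
  "weighted_norm_sq D \<omega> g = (\<integral>\<^sup>+z. ennreal ((cmod (g z))\<^sup>2 * (indicator D z * \<omega> z)) \<partial>lborel)"
  unfolding weighted_norm_sq_def by (intro nn_integral_cong) (auto simp: indicator_def)

lemma weighted_inner_cnj: "weighted_inner D \<omega> h g = cnj (weighted_inner D \<omega> g h)"
  unfolding weighted_inner_eq Bochner_Integration.integral_cnj[symmetric]
  by (intro Bochner_Integration.integral_cong) auto

lemma dirichlet_inner_cnj: "dirichlet_inner D \<omega> m h g = cnj (dirichlet_inner D \<omega> m g h)"
  unfolding dirichlet_inner_def by (subst (1 2) weighted_inner_cnj) simp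

text \<open>For two kernels, reproducing the section of \<open>L\<close> at w by \<open>K\<close>,
  and that of \<open>K\<close> at z by \<open>L\<close>, gives \<open>L z w = cnj (K w z)\<close>.
  The same identity with \<open>L\<close> replaced by \<open>K\<close> shows that \<open>K\<close>
  is Hermitian, whence both agree on \<open>D\<close>; elsewhere both are 0.\<close>

lemma reproducing_kernel_eqI:
  assumes ip: "\<And>g h. ip h g = cnj (ip g h)" and K: "is_reproducing_kernel D H ip K"
  shows "reproducing_kernel D H ip = K"
  unfolding reproducing_kernel_def
proof (rule the_equality)
  have sym: "L z w = cnj (K w z)" 
    if L: "is_reproducing_kernel D H ip L" and K: "is_reproducing_kernel D H ip K" 
      and zw: "z \<in> D" "w \<in> D" for K L z w
  proof -
    have H: "(\<lambda>x. L x w) \<in> H" "(\<lambda>x. K x z) \<in> H"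
      using L K zw unfolding is_reproducing_kernel_def by simp_all
    have repr: "f z = ip f (\<lambda>x. K x z)" "f w = ip f (\<lambda>x. L x w)" if "f \<in> H" for f
      using L K zw that unfolding is_reproducing_kernel_def by simp_all
    have "L z w = cnj (ip (\<lambda>x. K x z) (\<lambda>x. L x w))"
      by (subst ip[symmetric]) (rule repr(1)[OF H(1)])
    then show ?thesis
      by (simp flip: repr(2)[OF H(2)])
  qed
  fix L assume L: "is_reproducing_kernel D H ip L"
  show "L = K"
  proof (intro ext)
    fix z w
    show "L z w = K z w"
    proof (cases "z \<in> D \<and> w \<in> D")
      case True
      then show ?thesis using sym[OF L K] sym[OF K K] by metis
    next
      case False
      then show ?thesis using L K unfolding is_reproducing_kernel_def by auto
    qed
  qed
qed (rule K)

section \<open>Weights positive exactly on a disc or the plane: moment growth and Parseval\<close>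

text \<open>For radius \<open>\<infinity>\<close> the set \<open>eball 0 \<rho>\<close> is the whole
  plane, the Bargmann case; a finite radius is the Bergman case.\<close>

locale dirichlet_weight = radial_weight u for u :: "complex \<Rightarrow> real" +
  fixes \<rho> :: ereal
  assumes radius_pos: "\<rho> > 0"
    and weight_pos: "z \<in> eball 0 \<rho> \<Longrightarrow> u z > 0"
    and weight_outside: "z \<notin> eball 0 \<rho> \<Longrightarrow> u z = 0"
begin

abbreviation "D \<equiv> eball (0 :: complex) \<rho>"
lemma restricted_weight_measurable [measurable]:
  "(\<lambda>z. indicator (ball 0 r) z * u z) \<in> borel_measurable borel"
  by (rule radial_weight.weight_measurable[OF radial_weight_ball])

abbreviation "moment_restricted r \<equiv> moment (\<lambda>z. indicator (ball 0 r) z * u z)"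

text \<open>The constant is the mass of \<open>u\<close> outside radius \<open>r\<close>, where
  \<open>cmod z\<close> exceeds \<open>r\<close>; it is positive because \<open>u\<close> is
  positive on the annulus between \<open>r\<close> and \<open>\<rho>\<close>.\<close>

lemma moment_lower_bound:
  assumes "r \<ge> 0" "ereal r < \<rho>"
  obtains c where "c > 0" "\<And>k. c * r ^ (2 * k) \<le> moment u k"
proof
  define f where "f z = indicator {z. cmod z > r} z * u z" for z
  have [measurable]: "f \<in> borel_measurable borel"
    unfolding f_def by measurable
  have u: "integrable lborel u"
    using moments_integrable[of 0] by simp
  have f: "integrable lborel f"
    using u by (rule Bochner_Integration.integrable_bound) (auto simp: f_def indicator_def)
  have f0: "f z \<ge> 0" for z
    using weight_nonneg[of z] by (simp add: f_def)
  have "integral\<^sup>L lborel f \<noteq> 0"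
  proof
    assume "integral\<^sup>L lborel f = 0"
    then have "AE z in lborel. f z = 0"
      using integral_nonneg_eq_0_iff_AE[OF f] f0 by simp
    then have ae: "AE z in lebesgue. f z = 0"
      by (rule AE_completion)
    obtain s where s: "ereal r < ereal s" "ereal s < \<rho>"
      using ereal_dense2[OF assms(2)] by auto
    \<comment> \<open>Were the mass zero, almost every point of the open set \<open>?S\<close> would
      lie in the closed set \<open>{}\<close>, hence every point would; but \<open>of_real s\<close>
      is in \<open>?S\<close>.\<close>
    let ?S = "{z. cmod z > r} \<inter> D"
    have "open {z::complex. cmod z > r}"
      by (intro open_Collect_less continuous_intros)
    then have "open ?S"
      by auto
    moreover have "AE z\<in>?S in lebesgue. z \<in> {}"
      using ae
    proof eventually_elim
      case (elim z)
      then show ?case using weight_pos[of z] by (auto simp: f_def)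
    qed
    moreover have "of_real s \<in> ?S"
      using s assms(1) by auto
    ultimately show False
      using mem_closed_if_AE_lebesgue_open[of ?S "{}"] by blast
  qed
  then show "integral\<^sup>L lborel f > 0"
    using integral_nonneg_AE[of f lborel] f0 by (simp add: less_le)
  show "integral\<^sup>L lborel f * r ^ (2 * k) \<le> moment u k" for k
  proof -
    have "integral\<^sup>L lborel f * r ^ (2 * k) = (\<integral>z. f z * r ^ (2 * k) \<partial>lborel)"
      by simp
    also have "\<dots> \<le> moment u k"
      unfolding moment_def
    proof (rule integral_mono)
      show "integrable lborel (\<lambda>z. f z * r ^ (2 * k))" using f by simp
      fix z :: complex
      have "r ^ (2 * k) \<le> cmod z ^ (2 * k)" if "cmod z > r"
        using that assms(1) by (intro power_mono) auto
      then show "f z * r ^ (2 * k) \<le> cmod z ^ (2 * k) * u z"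
        using weight_nonneg[of z] mult_right_mono[OF _ weight_nonneg[of z], of "r ^ (2 * k)" "cmod z ^ (2 * k)"]
        by (auto simp: f_def indicator_def mult.commute)
    qed (rule moments_integrable)
    finally show ?thesis .
  qed
qed

lemma moment_pos: "moment u k > 0"
proof -
  obtain r where r: "0 < ereal r" "ereal r < \<rho>"
    using ereal_dense2[OF radius_pos] by auto
  then have "r > 0" by (simp add: zero_ereal_def)
  then obtain c where "c > 0" "\<And>k. c * r ^ (2 * k) \<le> moment u k"
    using moment_lower_bound[of r] r by auto
  then show ?thesis
    using \<open>r > 0\<close> by (meson less_le_trans mult_pos_pos zero_less_power)
qed

lemma exhaustion:
  obtains X :: "nat \<Rightarrow> real"
  where "incseq X" "\<And>i. X i \<ge> 0" "\<And>i. ereal (X i) < \<rho>"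
    "\<And>z. \<forall>\<^sub>F i in sequentially. indicator (ball 0 (X i)) z * u z = u z"
proof -
  obtain X :: "nat \<Rightarrow> real" where X: "incseq X" "\<And>i. 0 < ereal (X i)" "\<And>i. ereal (X i) < \<rho>"
      "(\<lambda>i. ereal (X i)) \<longlonglongrightarrow> \<rho>"
    using ereal_incseq_approx[OF radius_pos] by blast
  have "\<forall>\<^sub>F i in sequentially. indicator (ball 0 (X i)) z * u z = u z" for z
  proof (cases "z \<in> D")
    case True
    then have "\<forall>\<^sub>F i in sequentially. ereal (cmod z) < ereal (X i)"
      using X(4) by (intro order_tendstoD) auto
    then show ?thesis
      by eventually_elim auto
  qed (simp add: weight_outside)
  moreover have "X i \<ge> 0" for i
    using X(2)[of i] by (simp add: zero_ereal_def)
  ultimately show thesis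
    using that X by blast
qed

text \<open>On each disc Parseval holds with the truncated moments. These converge to the moments of
  \<open>u\<close> and never exceed them, so \<open>AB\<close> is the majorant for Tannery's
  theorem.\<close>

lemma parseval_exhaustion:
  fixes A B :: "nat \<Rightarrow> complex"
  assumes A: "\<And>r. r \<ge> 0 \<Longrightarrow> ereal r < \<rho> \<Longrightarrow> summable (\<lambda>k. cmod (A k) * r ^ k)"
    and B: "\<And>r. r \<ge> 0 \<Longrightarrow> ereal r < \<rho> \<Longrightarrow> summable (\<lambda>k. cmod (B k) * r ^ k)"
    and AB: "summable (\<lambda>k. cmod (A k) * cmod (B k) * moment u k)"
    and X: "\<And>i. X i \<ge> 0" "\<And>i. ereal (X i) < \<rho>"
    "\<And>z. \<forall>\<^sub>F i in sequentially. indicator (ball 0 (X i)) z * u z = u z"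
  defines "f \<equiv> \<lambda>z. (\<Sum>k. A k * z ^ k) * cnj (\<Sum>k. B k * z ^ k)"
  shows "integrable lborel (\<lambda>z. f z * of_real (indicator (ball 0 (X i)) z * u z))"
    and "(\<lambda>i. \<integral>z. f z * of_real (indicator (ball 0 (X i)) z * u z) \<partial>lborel)
            \<longlonglongrightarrow> (\<Sum>k. A k * cnj (B k) * of_real (moment u k))"
proof -
  have supp: "indicator (ball 0 (X i)) z * u z = 0" if "cmod z > X i" for i z
    using that by (simp add: indicator_def)
  note par = radial_weight.parseval_bounded_support[OF radial_weight_ball supp X(1) A[OF X(1,2)] B[OF X(1,2)]]
  show "integrable lborel (\<lambda>z. f z * of_real (indicator (ball 0 (X i)) z * u z))" for i
    unfolding f_def by (rule par(2))
  have mom: "(\<lambda>i. moment_restricted (X i) k) \<longlonglongrightarrow> moment u k" for k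
    unfolding moment_def
  proof (rule integral_dominated_convergence)
    show "integrable lborel (\<lambda>z. cmod z ^ (2 * k) * u z)"
      by (rule moments_integrable)
    show "AE z in lborel. (\<lambda>i. cmod z ^ (2 * k) * (indicator (ball 0 (X i)) z * u z)) \<longlonglongrightarrow> cmod z ^ (2 * k) * u z"
      using X(3) by (intro AE_I2 tendsto_mult_left tendsto_eventually)
    show "AE z in lborel. norm (cmod z ^ (2 * k) * (indicator (ball 0 (X i)) z * u z)) \<le> cmod z ^ (2 * k) * u z" for i
      using weight_nonneg by (intro AE_I2) (auto simp: abs_mult indicator_def mult_nonneg_nonneg)
  qed (auto intro!: borel_measurable_times restricted_weight_measurable)
  have mom_le: "moment_restricted (X i) k \<le> moment u k" for i k
    unfolding moment_def
    using radial_weight.moments_integrable[OF radial_weight_ball] moments_integrable weight_nonneg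
    by (intro integral_mono) (auto simp: indicator_def)
  have mom_nonneg: "moment_restricted (X i) k \<ge> 0" for i k
    by (rule radial_weight.moment_nonneg[OF radial_weight_ball])
  have "(\<lambda>i. \<Sum>k. A k * cnj (B k) * of_real (moment_restricted (X i) k))
          \<longlonglongrightarrow> (\<Sum>k. A k * cnj (B k) * of_real (moment u k))"
  proof (rule tannerys_theorem[THEN conjunct2, THEN conjunct2])
    show "(\<lambda>i. A k * cnj (B k) * of_real (moment_restricted (X i) k))
            \<longlonglongrightarrow> A k * cnj (B k) * of_real (moment u k)" for k
      using mom by (intro tendsto_intros)
    show "\<forall>\<^sub>F (k, i) in sequentially \<times>\<^sub>F sequentially.
            norm (A k * cnj (B k) * of_real (moment_restricted (X i) k)) \<le> cmod (A k) * cmod (B k) * moment u k"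
      using mom_le mom_nonneg
      by (intro always_eventually) (auto simp: norm_mult intro!: mult_left_mono)
  qed (use AB in auto)
  moreover have "(\<Sum>k. A k * cnj (B k) * of_real (moment_restricted (X i) k))
          = (\<integral>z. f z * of_real (indicator (ball 0 (X i)) z * u z) \<partial>lborel)" for i
    unfolding f_def by (rule sums_unique[OF par(1), symmetric])
  ultimately show "(\<lambda>i. \<integral>z. f z * of_real (indicator (ball 0 (X i)) z * u z) \<partial>lborel)
            \<longlonglongrightarrow> (\<Sum>k. A k * cnj (B k) * of_real (moment u k))"
    by (simp only:)
qed

text \<open>Both sides are limits of the same truncated integrals; \<open>int\<close> supplies the
  dominating function for the left one.\<close>

lemma parseval:
  fixes A B :: "nat \<Rightarrow> complex"
  assumes A: "\<And>r. r \<ge> 0 \<Longrightarrow> ereal r < \<rho> \<Longrightarrow> summable (\<lambda>k. cmod (A k) * r ^ k)"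
    and B: "\<And>r. r \<ge> 0 \<Longrightarrow> ereal r < \<rho> \<Longrightarrow> summable (\<lambda>k. cmod (B k) * r ^ k)"
    and AB: "summable (\<lambda>k. cmod (A k) * cmod (B k) * moment u k)"
    and int: "integrable lborel (\<lambda>z. (\<Sum>k. A k * z ^ k) * cnj (\<Sum>k. B k * z ^ k) * of_real (u z))"
  shows "(\<integral>z. (\<Sum>k. A k * z ^ k) * cnj (\<Sum>k. B k * z ^ k) * of_real (u z) \<partial>lborel)
           = (\<Sum>k. A k * cnj (B k) * of_real (moment u k))"
proof -
  define f where "f z = (\<Sum>k. A k * z ^ k) * cnj (\<Sum>k. B k * z ^ k)" for z
  obtain X :: "nat \<Rightarrow> real" where X: "incseq X" "\<And>i. X i \<ge> 0" "\<And>i. ereal (X i) < \<rho>"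
    "\<And>z. \<forall>\<^sub>F i in sequentially. indicator (ball 0 (X i)) z * u z = u z"
    using exhaustion by blast
  have "(\<lambda>i. \<integral>z. f z * of_real (indicator (ball 0 (X i)) z * u z) \<partial>lborel)
          \<longlonglongrightarrow> (\<integral>z. f z * of_real (u z) \<partial>lborel)"
  proof (rule integral_dominated_convergence)
    show "integrable lborel (\<lambda>z. norm (f z * of_real (u z)))"
      using int by (intro integrable_norm) (simp add: f_def)
    have [measurable]: "f \<in> borel_measurable borel"
      unfolding f_def by measurable
    show "(\<lambda>z. f z * of_real (u z)) \<in> borel_measurable lborel"
      by simp
    show "(\<lambda>z. f z * of_real (indicator (ball 0 (X i)) z * u z)) \<in> borel_measurable lborel" for i
    proof (rule borel_measurable_times)
      show "(\<lambda>z. complex_of_real (indicator (ball 0 (X i)) z * u z)) \<in> borel_measurable lborel"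
        using measurable_compose[OF restricted_weight_measurable borel_measurable_of_real]
        by (simp del: of_real_mult)
    qed simp
    have "(\<lambda>i. complex_of_real (indicator (ball 0 (X i)) z * u z)) \<longlonglongrightarrow> of_real (u z)" for z
      using X(4) by (intro tendsto_of_real tendsto_eventually)
    then show "AE z in lborel. (\<lambda>i. f z * of_real (indicator (ball 0 (X i)) z * u z)) \<longlonglongrightarrow> f z * of_real (u z)"
      by (intro AE_I2 tendsto_mult_left)
    show "AE z in lborel. norm (f z * of_real (indicator (ball 0 (X i)) z * u z)) \<le> norm (f z * of_real (u z))" for i
      by (intro AE_I2) (auto simp: indicator_def)
  qed
  from LIMSEQ_unique[OF this] parseval_exhaustion(2)[OF A B AB X(2-4)] show ?thesis
    by (simp add: f_def)
qed

text \<open>The truncated integrals increase to the finite sum in \<open>BB\<close>, so monotone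
  convergence applies. This is what puts the kernel sections into the space.\<close>

lemma power_series_square_integrable:
  assumes B: "\<And>r. r \<ge> 0 \<Longrightarrow> ereal r < \<rho> \<Longrightarrow> summable (\<lambda>k. cmod (B k) * r ^ k)"
    and BB: "summable (\<lambda>k. (cmod (B k))\<^sup>2 * moment u k)"
  shows "integrable lborel (\<lambda>z. (cmod (\<Sum>k. B k * z ^ k))\<^sup>2 * u z)"
proof -
  define g where "g z = (\<Sum>k. B k * z ^ k)" for z
  have [measurable]: "g \<in> borel_measurable borel"
    unfolding g_def by measurable
  obtain X :: "nat \<Rightarrow> real" where X: "incseq X" "\<And>i. X i \<ge> 0" "\<And>i. ereal (X i) < \<rho>"
    "\<And>z. \<forall>\<^sub>F i in sequentially. indicator (ball 0 (X i)) z * u z = u z"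
    using exhaustion by blast
  have BB': "summable (\<lambda>k. cmod (B k) * cmod (B k) * moment u k)"
    using BB by (simp add: power2_eq_square)
  have eq: "g z * cnj (g z) * of_real x = complex_of_real ((cmod (g z))\<^sup>2 * x)" for z x
    by (simp only: of_real_mult complex_norm_square)
  have par1: "integrable lborel (\<lambda>z. g z * cnj (g z) * of_real (indicator (ball 0 (X i)) z * u z))" for i
    unfolding g_def by (rule parseval_exhaustion(1)[OF B B BB' X(2-4)]) assumption+
  have par2: "(\<lambda>i. \<integral>z. g z * cnj (g z) * of_real (indicator (ball 0 (X i)) z * u z) \<partial>lborel)
            \<longlonglongrightarrow> (\<Sum>k. B k * cnj (B k) * of_real (moment u k))"
    unfolding g_def by (rule parseval_exhaustion(2)[OF B B BB' X(2-4)]) assumption+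
  show ?thesis
    unfolding g_def[symmetric]
  proof (rule integral_monotone_convergence_nonneg(1))
    show "integrable lborel (\<lambda>z. (cmod (g z))\<^sup>2 * (indicator (ball 0 (X i)) z * u z))" for i
      using par1[of i] unfolding eq by (subst (asm) complex_of_real_integrable_eq)
    show "AE z in lborel. mono (\<lambda>i. (cmod (g z))\<^sup>2 * (indicator (ball 0 (X i)) z * u z))"
      using weight_nonneg X(1)
      by (intro AE_I2 monoI mult_left_mono mult_right_mono)
         (auto simp: indicator_def dest: incseqD)
    show "AE z in lborel. 0 \<le> (cmod (g z))\<^sup>2 * (indicator (ball 0 (X i)) z * u z)" for i
      using weight_nonneg by (intro AE_I2 mult_nonneg_nonneg) auto
    show "AE z in lborel. (\<lambda>i. (cmod (g z))\<^sup>2 * (indicator (ball 0 (X i)) z * u z)) \<longlonglongrightarrow> (cmod (g z))\<^sup>2 * u z"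
      using X(4) by (intro AE_I2 tendsto_mult_left tendsto_eventually)
    show "(\<lambda>i. \<integral>z. (cmod (g z))\<^sup>2 * (indicator (ball 0 (X i)) z * u z) \<partial>lborel)
            \<longlonglongrightarrow> Re (\<Sum>k. B k * cnj (B k) * of_real (moment u k))"
      using tendsto_Re[OF par2] unfolding eq by (simp del: of_real_mult)
  qed simp
qed

end

section \<open>The kernel series and its reproducing property\<close>

text \<open>The squared Dirichlet norm of \<open>z ^ n\<close>: below \<open>m\<close> the monomial
  is its own low part, and from \<open>m\<close> on its m-th derivative is
  \<open>fact n / fact (n - m) * z ^ (n - m)\<close>.\<close>

definition norm_coeff :: "nat \<Rightarrow> (complex \<Rightarrow> real) \<Rightarrow> nat \<Rightarrow> real" where
  "norm_coeff m u n =
     (if n < m then moment u n else (fact n / fact (n - m))\<^sup>2 * moment u (n - m))"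

definition series_kernel :: "nat \<Rightarrow> (complex \<Rightarrow> real) \<Rightarrow> complex \<Rightarrow> complex \<Rightarrow> complex" where
  "series_kernel m u z w = (\<Sum>n. (z * cnj w) ^ n / of_real (norm_coeff m u n))"

context dirichlet_weight
begin

lemma norm_coeff_pos: "norm_coeff m u n > 0"
  unfolding norm_coeff_def using moment_pos by simp

text \<open>For x < r < \<open>\<rho>\<close> the growth of the moments gives a geometric majorant
  of ratio (x/r)^2; the factorial quotient is at least 1 and only enlarges the denominators.\<close>

lemma kernel_majorant_summable:
  assumes "x \<ge> 0" "ereal x < \<rho>"
  shows "summable (\<lambda>n. x ^ (2 * n) / norm_coeff m u n)"
proof -
  obtain r where r: "x < r" "ereal r < \<rho>"
    using ereal_dense2[OF assms(2)] by auto
  then have r0: "r > 0"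
    using assms(1) by linarith
  obtain c where c: "c > 0" "\<And>k. c * r ^ (2 * k) \<le> moment u k"
    using moment_lower_bound[of r] r r0 by auto
  have "(x / r)\<^sup>2 < 1"
    using r assms(1) r0 by (simp add: power_less_one_iff)
  \<comment> \<open>The factor \<open>r ^ (2 * m)\<close> makes up for the shift from n to n - m in
    the moments, so the comparison starts at n = m.\<close>
  then have sum: "summable (\<lambda>n. ((x / r)\<^sup>2) ^ n * (r ^ (2 * m) / c))"
    by (intro summable_mult2 summable_geometric) simp
  show ?thesis
  proof (rule summable_comparison_test'[OF sum, of m])
    fix n assume n: "n \<ge> m"
    have "c * r ^ (2 * (n - m)) \<le> moment u (n - m)"
      by (rule c(2))
    also have "\<dots> \<le> (fact n / fact (n - m))\<^sup>2 * moment u (n - m)"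
    proof -
      have "(fact (n - m) :: real) \<le> fact n"
        by (rule fact_mono) simp
      then have "1 \<le> (fact n / fact (n - m) :: real)\<^sup>2"
        by (intro one_le_power) simp
      then show ?thesis
        using mult_right_mono[OF _ less_imp_le[OF moment_pos]] by fastforce
    qed
    also have "\<dots> = norm_coeff m u n"
      using n by (simp add: norm_coeff_def)
    finally have "x ^ (2 * n) / norm_coeff m u n \<le> x ^ (2 * n) / (c * r ^ (2 * (n - m)))"
      using assms(1) c(1) r0 by (intro divide_left_mono) (auto simp: norm_coeff_pos)
    also have "\<dots> = ((x / r)\<^sup>2) ^ n * (r ^ (2 * m) / c)"
    proof -
      have "r ^ (2 * n) = r ^ (2 * (n - m)) * r ^ (2 * m)"
        using n by (simp flip: power_add add: algebra_simps)
      then show ?thesis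
        using r0 c(1) by (simp add: power_divide power_mult[symmetric] field_simps)
    qed
    finally show "norm (x ^ (2 * n) / norm_coeff m u n) \<le> ((x / r)\<^sup>2) ^ n * (r ^ (2 * m) / c)"
      using assms(1) norm_coeff_pos[of m n] by simp
  qed
qed

lemma kernel_section_coeff_summable:
  assumes "w \<in> D" "r \<ge> 0" "ereal r < \<rho>"
  shows "summable (\<lambda>n. cmod (cnj w ^ n / of_real (norm_coeff m u n)) * r ^ n)"
proof -
  \<comment> \<open>A single radius, still inside the disc, that bounds both factors, so that the
    majorant x^(2n)/c_n applies.\<close>
  define x where "x = max (cmod w) r"
  have x: "x \<ge> 0" "ereal x < \<rho>"
    using assms by (auto simp: x_def max_def)
  show ?thesis
  proof (rule summable_comparison_test'[OF kernel_majorant_summable[OF x, of m], of 0])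
    fix n
    have "cmod w ^ n * r ^ n \<le> x ^ n * x ^ n"
      using assms(2) by (intro mult_mono power_mono) (auto simp: x_def)
    then show "norm (cmod (cnj w ^ n / of_real (norm_coeff m u n)) * r ^ n) \<le> x ^ (2 * n) / norm_coeff m u n"
      using assms(2) norm_coeff_pos[of m n]
      by (simp add: norm_mult norm_divide norm_power divide_right_mono mult_2 power_add)
  qed
qed

text \<open>Low parts are polynomials, so a finite double sum and orthogonality suffice.\<close>

lemma low_part_inner_product:
  shows "(\<integral>z. low_part m f z * cnj (low_part m g z) * of_real (u z) \<partial>lborel)
     = (\<Sum>n<m. fps_nth (fps_expansion f 0) n * cnj (fps_nth (fps_expansion g 0) n) * of_real (moment u n))"
  and "integrable lborel (\<lambda>z. low_part m f z * cnj (low_part m g z) * of_real (u z))"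
proof -
  let ?a = "\<lambda>n. fps_nth (fps_expansion f 0) n" and ?b = "\<lambda>n. fps_nth (fps_expansion g 0) n"
  have int: "integrable lborel (\<lambda>z. z ^ j * cnj (z ^ k) * complex_of_real (u z))" for j k
    by (rule integrable_bounded_by_power[of _ 1 "j + k"]) (auto simp: norm_mult norm_power power_add)
  have eq: "low_part m f z * cnj (low_part m g z) * of_real (u z)
          = (\<Sum>j<m. \<Sum>k<m. ?a j * cnj (?b k) * (z ^ j * cnj (z ^ k) * of_real (u z)))" for z
    unfolding low_part_def cnj_sum sum_product unfolding sum_distrib_right
    by (intro sum.cong refl) (simp add: mult_ac)
  have "(\<integral>z. low_part m f z * cnj (low_part m g z) * of_real (u z) \<partial>lborel)
     = (\<Sum>j<m. \<integral>z. (\<Sum>k<m. ?a j * cnj (?b k) * (z ^ j * cnj (z ^ k) * of_real (u z))) \<partial>lborel)"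
    unfolding eq
    by (intro Bochner_Integration.integral_sum Bochner_Integration.integrable_sum integrable_mult_right int)
  also have "\<dots> = (\<Sum>j<m. \<Sum>k<m. \<integral>z. ?a j * cnj (?b k) * (z ^ j * cnj (z ^ k) * of_real (u z)) \<partial>lborel)"
    by (intro sum.cong refl Bochner_Integration.integral_sum integrable_mult_right int)
  also have "\<dots> = (\<Sum>j<m. \<Sum>k<m. ?a j * cnj (?b k) * (if j = k then of_real (moment u k) else 0))"
    by (intro sum.cong refl) (simp only: integral_mult_right_zero monomials_orthogonal)
  also have "\<dots> = (\<Sum>n<m. ?a n * cnj (?b n) * of_real (moment u n))"
    by (intro sum.cong refl) (simp add: if_distrib cong: if_cong)
  finally show "(\<integral>z. low_part m f z * cnj (low_part m g z) * of_real (u z) \<partial>lborel)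
     = (\<Sum>n<m. ?a n * cnj (?b n) * of_real (moment u n))" .
  show "integrable lborel (\<lambda>z. low_part m f z * cnj (low_part m g z) * of_real (u z))"
    unfolding eq using int by (intro Bochner_Integration.integrable_sum integrable_mult_right)
qed

end

text \<open>By \<open>high_part_deriv\<close>, the Taylor coefficient of the m-th derivative of the
  high part.\<close>

definition high_coeff :: "nat \<Rightarrow> (complex \<Rightarrow> complex) \<Rightarrow> nat \<Rightarrow> complex" where
  "high_coeff m f k = fact (k + m) / fact k * fps_nth (fps_expansion f 0) (k + m)"

context dirichlet_weight
begin

lemma high_part_power_series:
  assumes "f holomorphic_on D"
  shows "z \<in> D \<Longrightarrow> (deriv ^^ m) (high_part m f) z = (\<Sum>k. high_coeff m f k * z ^ k)"
    and "r \<ge> 0 \<Longrightarrow> ereal r < \<rho> \<Longrightarrow> summable (\<lambda>k. cmod (high_coeff m f k) * r ^ k)"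
  using power_series_expansion_sums[OF high_part_deriv(1)[OF assms radius_pos, of m]]
    power_series_expansion_abs_summable[OF high_part_deriv(1)[OF assms radius_pos, of m]]
  unfolding high_part_deriv(2)[OF assms radius_pos] high_coeff_def[symmetric]
  by (simp_all add: sums_iff)

lemma norm_coeff_shift:
  "norm_coeff m u (k + m) = (fact (k + m) / fact k)\<^sup>2 * moment u k"
  by (simp add: norm_coeff_def)

text \<open>Pointwise |F G| is at most |F|^2 + |G|^2. This provides the integrability that
  \<open>parseval\<close> assumes.\<close>

lemma square_integrable_product:
  fixes F G :: "complex \<Rightarrow> complex"
  assumes [measurable]: "F \<in> borel_measurable borel" "G \<in> borel_measurable borel"
    and F: "integrable lborel (\<lambda>z. (cmod (F z))\<^sup>2 * u z)"
    and G: "integrable lborel (\<lambda>z. (cmod (G z))\<^sup>2 * u z)"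
  shows "integrable lborel (\<lambda>z. F z * cnj (G z) * of_real (u z))"
proof (rule Bochner_Integration.integrable_bound)
  show "integrable lborel (\<lambda>z. (cmod (F z))\<^sup>2 * u z + (cmod (G z))\<^sup>2 * u z)"
    using F G by simp
  show "AE z in lborel. norm (F z * cnj (G z) * of_real (u z)) \<le> norm ((cmod (F z))\<^sup>2 * u z + (cmod (G z))\<^sup>2 * u z)"
  proof (rule AE_I2)
    fix z
    have "2 * (cmod (F z) * cmod (G z)) \<le> (cmod (F z))\<^sup>2 + (cmod (G z))\<^sup>2"
      using sum_squares_bound[of "cmod (F z)" "cmod (G z)"] by simp
    moreover have "0 \<le> cmod (F z) * cmod (G z)"
      by simp
    ultimately have "cmod (F z) * cmod (G z) \<le> (cmod (F z))\<^sup>2 + (cmod (G z))\<^sup>2"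
      by linarith
    then have "cmod (F z) * cmod (G z) * u z \<le> ((cmod (F z))\<^sup>2 + (cmod (G z))\<^sup>2) * u z"
      by (intro mult_right_mono weight_nonneg)
    then show "norm (F z * cnj (G z) * of_real (u z)) \<le> norm ((cmod (F z))\<^sup>2 * u z + (cmod (G z))\<^sup>2 * u z)"
      using weight_nonneg[of z] by (simp add: norm_mult distrib_right)
  qed
qed simp

text \<open>The value 0 off \<open>D\<close> is the normalisation in
  \<open>is_reproducing_kernel\<close>; as \<open>D\<close> is a neighbourhood of 0, the
  coefficients can still be read off the series.\<close>

lemma kernel_section_expansion:
  fixes m :: nat and w :: complex
  assumes "w \<in> D"
  defines "g \<equiv> \<lambda>z. if z \<in> D \<and> w \<in> D then series_kernel m u z w else 0"
  shows "g holomorphic_on D"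
    and "fps_nth (fps_expansion g 0) n = cnj w ^ n / of_real (norm_coeff m u n)"
proof -
  have "g z = (\<Sum>n. cnj w ^ n / of_real (norm_coeff m u n) * z ^ n)" if "z \<in> D" for z
    using that assms(1) by (simp add: g_def series_kernel_def power_mult_distrib mult_ac)
  from holomorphic_on_eball_power_series[OF radius_pos kernel_section_coeff_summable[OF assms(1)] this]
  show "g holomorphic_on D"
    and "fps_nth (fps_expansion g 0) n = cnj w ^ n / of_real (norm_coeff m u n)"
    by simp_all
qed

text \<open>The section at \<open>w\<close> has Taylor coefficients \<open>cnj w ^ n / c_n\<close>,
  so in Parseval's identity each c_n cancels. What remains is the Taylor series of \<open>f\<close>
  at \<open>w\<close>: the low parts give its first \<open>m\<close> terms, the derivatives of the
  high parts its tail.\<close>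

lemma is_reproducing_kernel_series:
  assumes \<omega>: "\<And>z. z \<in> D \<Longrightarrow> \<omega> z = u z"
  shows "is_reproducing_kernel D (dirichlet_space D \<omega> m) (dirichlet_inner D \<omega> m)
           (\<lambda>z w. if z \<in> D \<and> w \<in> D then series_kernel m u z w else 0)"
proof -
  have ind: "indicator D z * \<omega> z = u z" for z
    using \<omega>[of z] weight_outside[of z] by (cases "z \<in> D") simp_all
  \<comment> \<open>\<open>f\<close> and its derivatives are uncontrolled off \<open>D\<close>. The
    total function \<open>H f\<close> is Borel measurable and agrees with the m-th derivative
    wherever the weight is nonzero, so it can replace that derivative under every integral.\<close>
  define H where "H f z = (\<Sum>k. high_coeff m f k * z ^ k)" for f z
  have [measurable]: "H f \<in> borel_measurable borel" for f
    unfolding H_def by measurable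
  have H: "(deriv ^^ m) (high_part m f) z = H f z" if "f holomorphic_on D" "u z \<noteq> 0" for f z
    unfolding H_def using that weight_outside by (intro high_part_power_series) auto
  have norm_low: "weighted_norm_sq D \<omega> (low_part m f) < \<infinity>" for f
  proof -
    have eq: "low_part m f z * cnj (low_part m f z) * of_real (u z)
            = complex_of_real ((cmod (low_part m f z))\<^sup>2 * u z)" for z
      by (simp only: of_real_mult complex_norm_square)
    have "integrable lborel (\<lambda>z. (cmod (low_part m f z))\<^sup>2 * u z)"
      using low_part_inner_product(2)[of m f f] unfolding eq by (subst (asm) complex_of_real_integrable_eq)
    then show ?thesis
      unfolding weighted_norm_sq_eq ind by (auto simp: less_top[symmetric] dest: integrableD(2))
  qed
  have norm_high: "weighted_norm_sq D \<omega> ((deriv ^^ m) (high_part m f)) < \<infinity> \<longleftrightarrow>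
      integrable lborel (\<lambda>z. (cmod (H f z))\<^sup>2 * u z)" if f: "f holomorphic_on D" for f
  proof -
    have "weighted_norm_sq D \<omega> ((deriv ^^ m) (high_part m f))
            = (\<integral>\<^sup>+z. ennreal ((cmod (H f z))\<^sup>2 * u z) \<partial>lborel)"
      unfolding weighted_norm_sq_eq ind
    proof (rule nn_integral_cong)
      fix z
      show "ennreal ((cmod ((deriv ^^ m) (high_part m f) z))\<^sup>2 * u z) = ennreal ((cmod (H f z))\<^sup>2 * u z)"
        using H[OF f, of z] by (cases "u z = 0") simp_all
    qed
    also have "\<dots> = (\<integral>\<^sup>+z. ennreal (norm ((cmod (H f z))\<^sup>2 * u z)) \<partial>lborel)"
      using weight_nonneg by (simp add: abs_of_nonneg)
    finally show ?thesis
      by (simp add: integrable_iff_bounded)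
  qed
  have space: "f \<in> dirichlet_space D \<omega> m \<longleftrightarrow>
      f holomorphic_on D \<and> integrable lborel (\<lambda>z. (cmod (H f z))\<^sup>2 * u z)" for f
    using norm_low[of f] norm_high[of f]
    unfolding dirichlet_space_def dirichlet_norm_sq_def by auto
  show ?thesis
    unfolding is_reproducing_kernel_def
  proof (intro conjI ballI allI impI)
    fix w assume w: "w \<in> D"
    define g where "g = (\<lambda>z. if z \<in> D \<and> w \<in> D then series_kernel m u z w else 0)"
    have g: "g holomorphic_on D" 
      "\<And>n. fps_nth (fps_expansion g 0) n = cnj w ^ n / of_real (norm_coeff m u n)"
      unfolding g_def by (rule kernel_section_expansion[OF w])+
    have w': "ereal (cmod w) < \<rho>"
      using w by simp
    \<comment> \<open>One of the two factors c_(k+m) in the square cancels, leaving the tail of the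
      kernel majorant at x = |w|.\<close>
    have "(cmod (high_coeff m g k))\<^sup>2 * moment u k = cmod w ^ (2 * (k + m)) / norm_coeff m u (k + m)" for k
    proof -
      have "cmod w ^ (2 * (k + m)) = cmod w ^ (k + m) * cmod w ^ (k + m)"
        by (simp only: mult_2 power_add)
      then show ?thesis
        using moment_pos[of k]
        by (simp add: high_coeff_def g(2) norm_mult norm_divide norm_power norm_coeff_shift field_simps
            power2_eq_square)
    qed
    then have "summable (\<lambda>k. (cmod (high_coeff m g k))\<^sup>2 * moment u k)"
      using summable_ignore_initial_segment[OF kernel_majorant_summable[OF norm_ge_zero w', of m], of m]
      by simp
    then have intg: "integrable lborel (\<lambda>z. (cmod (H g z))\<^sup>2 * u z)"
      unfolding H_def by (intro power_series_square_integrable high_part_power_series(2)[OF g(1)])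
    then show "(\<lambda>z. if z \<in> D \<and> w \<in> D then series_kernel m u z w else 0) \<in> dirichlet_space D \<omega> m"
      unfolding space g_def[symmetric] using g(1) by simp
    fix f assume "f \<in> dirichlet_space D \<omega> m"
    then have f: "f holomorphic_on D" and intf: "integrable lborel (\<lambda>z. (cmod (H f z))\<^sup>2 * u z)"
      by (simp_all add: space)
    let ?a = "fps_nth (fps_expansion f 0)"
    have sums: "(\<lambda>n. ?a n * w ^ n) sums f w"
      by (rule power_series_expansion_sums[OF f w])
    have abs: "summable (\<lambda>n. cmod (?a n) * cmod w ^ n)"
      by (rule power_series_expansion_abs_summable[OF f norm_ge_zero w'])
    \<comment> \<open>The two factorial quotients and the moment multiply to c_(k+m), the
      denominator in the coefficient of \<open>g\<close>. Taking moduli, the summability required by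
      \<open>parseval\<close> is the absolute convergence of the Taylor series of \<open>f\<close>
      at \<open>w\<close>.\<close>
    have coeff_term: "high_coeff m f k * cnj (high_coeff m g k) * of_real (moment u k) = ?a (k + m) * w ^ (k + m)" for k
      using moment_pos[of k]
      by (simp add: high_coeff_def g(2) norm_coeff_shift field_simps power2_eq_square)
    have "cmod (high_coeff m f k) * cmod (high_coeff m g k) * moment u k = cmod (?a (k + m)) * cmod w ^ (k + m)" for k
      using arg_cong[OF coeff_term[of k], of cmod] moment_pos[of k] by (simp add: norm_mult norm_power)
    then have abs': "summable (\<lambda>k. cmod (high_coeff m f k) * cmod (high_coeff m g k) * moment u k)"
      using summable_ignore_initial_segment[OF abs, of m] by simp
    have "weighted_inner D \<omega> ((deriv ^^ m) (high_part m f)) ((deriv ^^ m) (high_part m g))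
            = (\<integral>z. H f z * cnj (H g z) * of_real (u z) \<partial>lborel)"
      unfolding weighted_inner_eq ind
    proof (rule Bochner_Integration.integral_cong)
      fix z
      show "(deriv ^^ m) (high_part m f) z * cnj ((deriv ^^ m) (high_part m g) z) * complex_of_real (u z)
             = H f z * cnj (H g z) * of_real (u z)"
        using H[OF f, of z] H[OF g(1), of z] by (cases "u z = 0") simp_all
    qed simp
    also have "\<dots> = (\<Sum>k. high_coeff m f k * cnj (high_coeff m g k) * of_real (moment u k))"
      unfolding H_def using square_integrable_product[OF _ _ intf intg]
      by (intro parseval high_part_power_series(2) f g(1) abs') (simp_all add: H_def)
    also have "\<dots> = (\<Sum>k. ?a (k + m) * w ^ (k + m))"
      by (simp only: coeff_term)
    finally have high: "weighted_inner D \<omega> ((deriv ^^ m) (high_part m f)) ((deriv ^^ m) (high_part m g))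
            = (\<Sum>k. ?a (k + m) * w ^ (k + m))" .
    have low: "weighted_inner D \<omega> (low_part m f) (low_part m g) = (\<Sum>n<m. ?a n * w ^ n)"
      unfolding weighted_inner_eq ind low_part_inner_product g(2)
      using moment_pos by (intro sum.cong refl) (simp add: norm_coeff_def less_imp_neq[symmetric])
    have "f w = (\<Sum>k. ?a (k + m) * w ^ (k + m)) + (\<Sum>n<m. ?a n * w ^ n)"
      using suminf_split_initial_segment[OF sums_summable[OF sums], of m] sums_unique[OF sums] by simp
    then show "f w = dirichlet_inner D \<omega> m f (\<lambda>z. if z \<in> D \<and> w \<in> D then series_kernel m u z w else 0)"
      unfolding dirichlet_inner_def g_def[symmetric] high low by simp
  qed auto
qed

lemma reproducing_kernel_dirichlet_space:
  assumes "\<And>z. z \<in> D \<Longrightarrow> \<omega> z = u z"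
  shows "reproducing_kernel D (dirichlet_space D \<omega> m) (dirichlet_inner D \<omega> m)
           = (\<lambda>z w. if z \<in> D \<and> w \<in> D then series_kernel m u z w else 0)"
  using dirichlet_inner_cnj is_reproducing_kernel_series[OF assms] by (rule reproducing_kernel_eqI)

end

section \<open>The limit of the kernels\<close>

lemma norm_coeff_mono:
  assumes "\<And>k. moment u k \<le> moment v k"
  shows "norm_coeff m u n \<le> norm_coeff m v n"
  using assms by (auto simp: norm_coeff_def intro!: mult_left_mono)

section \<open>Comparison of the Bergman weights with each other and with the Gaussian\<close>

text \<open>The extension by zero, with exponent \<open>\<nu> * R\<^sup>2\<close> built in, that
  \<open>dirichlet_weight\<close> asks for.\<close>

definition truncated_bergman_weight :: "real \<Rightarrow> real \<Rightarrow> complex \<Rightarrow> real" where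
  "truncated_bergman_weight \<nu> R z = indicator (ball 0 R) z * bergman_weight (\<nu> * R\<^sup>2) R z"

lemma truncated_bergman_weight_measurable [measurable]:
  "truncated_bergman_weight \<nu> R \<in> borel_measurable borel"
  unfolding truncated_bergman_weight_def[abs_def] bergman_weight_def powr_def
  by (intro borel_measurable_times borel_measurable_indicator) simp_all

lemma truncated_bergman_weight_inside:
  assumes "R > 0" "cmod z < R"
  shows "(cmod z)\<^sup>2 / R\<^sup>2 < 1" 
    and "truncated_bergman_weight \<nu> R z = exp (\<nu> * (R\<^sup>2 * ln (1 - (cmod z)\<^sup>2 / R\<^sup>2)))"
proof -
  show *: "(cmod z)\<^sup>2 / R\<^sup>2 < 1"
    using assms by (simp add: power_strict_mono)
  then show "truncated_bergman_weight \<nu> R z = exp (\<nu> * (R\<^sup>2 * ln (1 - (cmod z)\<^sup>2 / R\<^sup>2)))"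
    using assms by (simp add: truncated_bergman_weight_def bergman_weight_def norm_divide power_divide powr_def mult_ac)
qed

lemma truncated_bergman_weight_nonneg: "truncated_bergman_weight \<nu> R z \<ge> 0"
  by (simp add: truncated_bergman_weight_def bergman_weight_def)

text \<open>This is ln(1 - s) <= -s at s = |z|^2/R^2. The Gaussian thus dominates all these weights
  at once, which yields both their moments and the dominating function for R to infinity.\<close>

lemma truncated_bergman_weight_le_bargmann:
  assumes "\<nu> > 0" "R > 0"
  shows "truncated_bergman_weight \<nu> R z \<le> bargmann_weight \<nu> z"
proof (cases "cmod z < R")
  case True
  note inside = truncated_bergman_weight_inside[OF assms(2) True]
  have "ln (1 - (cmod z)\<^sup>2 / R\<^sup>2) \<le> - ((cmod z)\<^sup>2 / R\<^sup>2)"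
    using ln_le_minus_one[of "1 - (cmod z)\<^sup>2 / R\<^sup>2"] inside(1) by simp
  then have "R\<^sup>2 * ln (1 - (cmod z)\<^sup>2 / R\<^sup>2) \<le> R\<^sup>2 * - ((cmod z)\<^sup>2 / R\<^sup>2)"
    by (intro mult_left_mono) auto
  also have "\<dots> = - (cmod z)\<^sup>2"
    using assms(2) by simp
  finally have "\<nu> * (R\<^sup>2 * ln (1 - (cmod z)\<^sup>2 / R\<^sup>2)) \<le> \<nu> * - (cmod z)\<^sup>2"
    using assms(1) by (intro mult_left_mono) auto
  then show ?thesis
    unfolding inside(2) bargmann_weight_def by simp
qed (simp add: truncated_bergman_weight_def bargmann_weight_def)

text \<open>By concavity of \<open>ln\<close>, the map \<open>N \<mapsto> N ln (1 - s / N)\<close> is increasing.\<close>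

lemma truncated_bergman_weight_mono:
  assumes "\<nu> > 0" "0 < S" "S \<le> R"
  shows "truncated_bergman_weight \<nu> S z \<le> truncated_bergman_weight \<nu> R z"
proof (cases "cmod z < S")
  case True
  have "R > 0" "cmod z < R"
    using assms True by auto
  note inside = truncated_bergman_weight_inside[OF assms(2) True] truncated_bergman_weight_inside[OF this]
  \<comment> \<open>With this t, 1 - |z|^2/R^2 is the convex combination of 1 and 1 - |z|^2/S^2 with
    weight t on the latter. As ln 1 = 0, concavity leaves only the second term, and multiplying by
    R^2 turns t into S^2.\<close>
  define t where "t = S\<^sup>2 / R\<^sup>2"
  have t: "0 \<le> t" "t \<le> 1" "R\<^sup>2 * t = S\<^sup>2"
    using assms \<open>R > 0\<close> by (auto simp: t_def power_mono)
  have "(1 - t) * ln 1 + t * ln (1 - (cmod z)\<^sup>2 / S\<^sup>2)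
          \<le> ln ((1 - t) *\<^sub>R 1 + t *\<^sub>R (1 - (cmod z)\<^sup>2 / S\<^sup>2))"
    using inside(1) t by (intro concave_onD[OF ln_concave]) auto
  also have "(1 - t) *\<^sub>R 1 + t *\<^sub>R (1 - (cmod z)\<^sup>2 / S\<^sup>2) = 1 - (cmod z)\<^sup>2 / R\<^sup>2"
    using assms \<open>R > 0\<close> by (simp add: t_def field_simps)
  finally have "R\<^sup>2 * (t * ln (1 - (cmod z)\<^sup>2 / S\<^sup>2)) \<le> R\<^sup>2 * ln (1 - (cmod z)\<^sup>2 / R\<^sup>2)"
    by (intro mult_left_mono) auto
  then have "S\<^sup>2 * ln (1 - (cmod z)\<^sup>2 / S\<^sup>2) \<le> R\<^sup>2 * ln (1 - (cmod z)\<^sup>2 / R\<^sup>2)"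
    using t(3) by (simp flip: mult.assoc)
  then show ?thesis
    unfolding inside(2,4) using assms(1) by simp
qed (use truncated_bergman_weight_nonneg in \<open>simp add: truncated_bergman_weight_def[of _ S]\<close>)

lemma dirichlet_weight_bargmann:
  assumes "\<nu> > 0"
  shows "dirichlet_weight (bargmann_weight \<nu>) \<infinity>"
proof
  show "bargmann_weight \<nu> \<in> borel_measurable borel"
    unfolding bargmann_weight_def[abs_def] by measurable
  show "integrable lborel (\<lambda>z. cmod z ^ k * bargmann_weight \<nu> z)" for k
    unfolding bargmann_weight_def by (rule integrable_power_mult_gaussian[OF assms])
qed (auto simp: bargmann_weight_def norm_mult)

lemma dirichlet_weight_bergman:
  assumes "\<nu> > 0" "R > 0"
  shows "dirichlet_weight (truncated_bergman_weight \<nu> R) (ereal R)"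
proof
  interpret B: dirichlet_weight "bargmann_weight \<nu>" \<infinity>
    by (rule dirichlet_weight_bargmann[OF assms(1)])
  show "integrable lborel (\<lambda>z. cmod z ^ k * truncated_bergman_weight \<nu> R z)" for k
  proof (rule Bochner_Integration.integrable_bound[OF B.moments_integrable[of k]])
    show "AE z in lborel. norm (cmod z ^ k * truncated_bergman_weight \<nu> R z) \<le> norm (cmod z ^ k * bargmann_weight \<nu> z)"
      using truncated_bergman_weight_le_bargmann[OF assms] truncated_bergman_weight_nonneg
      by (intro AE_I2) (auto simp: abs_mult B.weight_nonneg intro!: mult_left_mono)
  qed simp
  show "truncated_bergman_weight \<nu> R z > 0" if "z \<in> eball 0 (ereal R)" for z
    using truncated_bergman_weight_inside(2)[OF assms(2), of z] that by simp
  show "truncated_bergman_weight \<nu> R (c * z) = truncated_bergman_weight \<nu> R z" if "cmod c = 1" for c z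
    using that by (simp add: truncated_bergman_weight_def bergman_weight_def norm_mult norm_divide indicator_def)
  show "truncated_bergman_weight \<nu> R z \<ge> 0" for z
    by (rule truncated_bergman_weight_nonneg)
qed (use assms in \<open>auto simp: truncated_bergman_weight_def zero_ereal_def\<close>)

lemma bargmann_dirichlet_kernel_eq:
  assumes "\<nu> > 0"
  shows "bargmann_dirichlet_kernel \<nu> m z w = series_kernel m (bargmann_weight \<nu>) z w"
proof -
  interpret dirichlet_weight "bargmann_weight \<nu>" \<infinity>
    by (rule dirichlet_weight_bargmann[OF assms])
  have UNIV: "(UNIV :: complex set) = eball 0 \<infinity>"
    by simp
  show ?thesis
    unfolding bargmann_dirichlet_kernel_def bargmann_dirichlet_space_def UNIV
    by (subst reproducing_kernel_dirichlet_space) simp_all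
qed

text \<open>Limited to arguments in the disc, since the kernel is normalised to 0 elsewhere; fixed
  arguments satisfy this once R is large.\<close>

lemma bergman_dirichlet_kernel_eq:
  assumes "\<nu> > 0" "R > 0" "cmod z < R" "cmod w < R"
  shows "bergman_dirichlet_kernel (\<nu> * R\<^sup>2) m R z w = series_kernel m (truncated_bergman_weight \<nu> R) z w"
proof -
  interpret dirichlet_weight "truncated_bergman_weight \<nu> R" "ereal R"
    by (rule dirichlet_weight_bergman[OF assms(1,2)])
  have ball: "ball (0::complex) R = eball 0 (ereal R)"
    by simp
  show ?thesis
    unfolding bergman_dirichlet_kernel_def bergman_dirichlet_space_def ball
    using assms(3,4)
    by (subst reproducing_kernel_dirichlet_space) (simp_all add: truncated_bergman_weight_def)
qed

lemma moment_bergman_tendsto: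
  assumes "\<nu> > 0"
  shows "((\<lambda>R. moment (truncated_bergman_weight \<nu> R) k) \<longlongrightarrow> moment (bargmann_weight \<nu>) k) at_top"
proof -
  interpret B: dirichlet_weight "bargmann_weight \<nu>" \<infinity>
    by (rule dirichlet_weight_bargmann[OF assms])
  have lim: "((\<lambda>R. truncated_bergman_weight \<nu> R z) \<longlongrightarrow> bargmann_weight \<nu> z) at_top" for z
  proof -
    \<comment> \<open>The classical limit of (1 + x/N)^N, taken along N = R^2 with x = -|z|^2 and
      then raised to the power \<nu>.\<close>
    have "filterlim (\<lambda>R::real. R\<^sup>2) at_top at_top"
      by real_asymp
    from filterlim_compose[OF tendsto_exp_limit_at_top this]
    have "((\<lambda>R. (1 + - (cmod z)\<^sup>2 / R\<^sup>2) powr R\<^sup>2) \<longlongrightarrow> exp (- (cmod z)\<^sup>2)) at_top" .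
    then have "((\<lambda>R. ((1 + - (cmod z)\<^sup>2 / R\<^sup>2) powr R\<^sup>2) powr \<nu>) \<longlongrightarrow> exp (- (cmod z)\<^sup>2) powr \<nu>) at_top"
      by (intro tendsto_intros) auto
    also have "exp (- (cmod z)\<^sup>2) powr \<nu> = bargmann_weight \<nu> z"
      by (simp add: bargmann_weight_def exp_powr_real mult.commute)
    finally show ?thesis
    proof (rule Lim_transform_eventually)
      show "\<forall>\<^sub>F R in at_top. ((1 + - (cmod z)\<^sup>2 / R\<^sup>2) powr R\<^sup>2) powr \<nu> = truncated_bergman_weight \<nu> R z"
        using eventually_gt_at_top[of "cmod z"]
        by eventually_elim
           (simp add: truncated_bergman_weight_def bergman_weight_def norm_divide power_divide powr_powr mult.commute)
    qed
  qed
  show ?thesis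
    unfolding moment_def
  proof (rule integral_dominated_convergence_at_top)
    show "integrable lborel (\<lambda>z. cmod z ^ (2 * k) * bargmann_weight \<nu> z)"
      by (rule B.moments_integrable)
    show "AE z in lborel. ((\<lambda>R. cmod z ^ (2 * k) * truncated_bergman_weight \<nu> R z)
        \<longlongrightarrow> cmod z ^ (2 * k) * bargmann_weight \<nu> z) at_top"
      using lim by (intro AE_I2 tendsto_mult_left)
    show "\<forall>\<^sub>F R in at_top. AE z in lborel.
        norm (cmod z ^ (2 * k) * truncated_bergman_weight \<nu> R z) \<le> cmod z ^ (2 * k) * bargmann_weight \<nu> z"
      using eventually_gt_at_top[of 0]
    proof eventually_elim
      case (elim R)
      show ?case
        using truncated_bergman_weight_le_bargmann[OF assms elim] truncated_bergman_weight_nonneg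
        by (intro AE_I2) (auto simp: abs_mult intro!: mult_left_mono)
    qed
  qed simp_all
qed

lemma moment_mono:
  assumes "radial_weight u" "radial_weight v" "\<And>z. u z \<le> v z"
  shows "moment u k \<le> moment v k"
  unfolding moment_def
  using assms(1,2)[THEN radial_weight.moments_integrable] assms(3)
  by (intro integral_mono) (auto intro: mult_left_mono)

section \<open>Uniform estimate on bidiscs and passage to the limit\<close>

text \<open>The bound is free of \<open>z\<close> and \<open>w\<close>, which reduces uniform
  convergence on a bidisc to the convergence of one numerical series. Two different radii are
  allowed, so that a disc can be compared with the plane.\<close>

lemma series_kernel_diff_bound:
  assumes u: "dirichlet_weight u \<rho>" and v: "dirichlet_weight v \<rho>'"
    and x: "ereal x < \<rho>" "ereal x < \<rho>'" and z: "cmod z \<le> x" and w: "cmod w \<le> x"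
  shows "cmod (series_kernel m u z w - series_kernel m v z w)
          \<le> (\<Sum>n. x ^ (2 * n) * \<bar>1 / norm_coeff m u n - 1 / norm_coeff m v n\<bar>)"
proof -
  have x0: "x \<ge> 0"
    using z norm_ge_zero[of z] by linarith
  have pow: "cmod ((z * cnj w) ^ n) \<le> x ^ (2 * n)" for n
  proof -
    have "cmod z ^ n * cmod w ^ n \<le> x ^ n * x ^ n"
      using z w x0 by (intro mult_mono power_mono) auto
    then show ?thesis
      by (simp add: norm_mult norm_power power_mult_distrib mult_2 power_add)
  qed
  have maj: "summable (\<lambda>n. x ^ (2 * n) / norm_coeff m v n)" 
    if "dirichlet_weight v \<rho>" "ereal x < \<rho>" for v \<rho>
    by (rule dirichlet_weight.kernel_majorant_summable[OF that(1) x0 that(2)])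
  have sum: "summable (\<lambda>n. (z * cnj w) ^ n / complex_of_real (norm_coeff m v n))"
    if "dirichlet_weight v \<rho>" "ereal x < \<rho>" for v \<rho>
  proof (rule summable_comparison_test'[OF maj[OF that], of 0])
    fix n
    show "norm ((z * cnj w) ^ n / complex_of_real (norm_coeff m v n)) \<le> x ^ (2 * n) / norm_coeff m v n"
      using dirichlet_weight.norm_coeff_pos[OF that(1), of m n] pow[of n]
      by (simp add: norm_divide divide_right_mono del: power_mult_distrib)
  qed
  have "series_kernel m u z w - series_kernel m v z w
     = (\<Sum>n. (z * cnj w) ^ n / of_real (norm_coeff m u n) - (z * cnj w) ^ n / of_real (norm_coeff m v n))"
    unfolding series_kernel_def by (rule suminf_diff[OF sum[OF u x(1)] sum[OF v x(2)]])
  also have "cmod \<dots> \<le> (\<Sum>n. x ^ (2 * n) * \<bar>1 / norm_coeff m u n - 1 / norm_coeff m v n\<bar>)"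
  proof (rule norm_suminf_le)
    fix n
    have "(z * cnj w) ^ n / of_real (norm_coeff m u n) - (z * cnj w) ^ n / of_real (norm_coeff m v n)
            = (z * cnj w) ^ n * of_real (1 / norm_coeff m u n - 1 / norm_coeff m v n)"
      by (simp add: right_diff_distrib del: power_mult_distrib)
    also have "cmod \<dots> \<le> x ^ (2 * n) * \<bar>1 / norm_coeff m u n - 1 / norm_coeff m v n\<bar>"
      unfolding norm_mult norm_of_real by (intro mult_right_mono) (use pow in \<open>simp_all add: norm_mult\<close>)
    finally show "norm ((z * cnj w) ^ n / of_real (norm_coeff m u n) - (z * cnj w) ^ n / of_real (norm_coeff m v n))
        \<le> x ^ (2 * n) * \<bar>1 / norm_coeff m u n - 1 / norm_coeff m v n\<bar>" .
  next
    show "summable (\<lambda>n. x ^ (2 * n) * \<bar>1 / norm_coeff m u n - 1 / norm_coeff m v n\<bar>)"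
    proof (rule summable_comparison_test'[OF summable_add[OF maj[OF u x(1)] maj[OF v x(2)]], of 0])
      fix n
      have "\<bar>1 / norm_coeff m u n - 1 / norm_coeff m v n\<bar> \<le> 1 / norm_coeff m u n + 1 / norm_coeff m v n"
        using dirichlet_weight.norm_coeff_pos[OF u, of m n] dirichlet_weight.norm_coeff_pos[OF v, of m n]
        by (intro order_trans[OF abs_triangle_ineq4]) simp
      from mult_left_mono[OF this, of "x ^ (2 * n)"] x0
      show "norm (x ^ (2 * n) * \<bar>1 / norm_coeff m u n - 1 / norm_coeff m v n\<bar>)
            \<le> x ^ (2 * n) / norm_coeff m u n + x ^ (2 * n) / norm_coeff m v n"
        by (simp add: distrib_left abs_mult)
    qed
  qed
  finally show ?thesis .
qed

text \<open>For R >= S both reciprocals lie between 0 and the one at S, hence so does the modulus of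
  their difference. The series at S is therefore a majorant independent of R, and each term tends to
  0 by convergence of the moments.\<close>

lemma kernel_majorant_tendsto_0:
  assumes "\<nu> > 0" "x \<ge> 0"
  shows "((\<lambda>R. \<Sum>n. x ^ (2 * n) * \<bar>1 / norm_coeff m (truncated_bergman_weight \<nu> R) n
            - 1 / norm_coeff m (bargmann_weight \<nu>) n\<bar>) \<longlongrightarrow> 0) at_top"
proof -
  let ?b = "truncated_bergman_weight \<nu>" and ?B = "bargmann_weight \<nu>"
  \<comment> \<open>Any fixed radius above \<open>x\<close> would serve; the majorant must converge
    at \<open>x\<close>.\<close>
  define S where "S = x + 1"
  have S: "S > 0" "ereal x < ereal S"
    using assms(2) by (auto simp: S_def)
  interpret B: dirichlet_weight ?B \<infinity>
    by (rule dirichlet_weight_bargmann[OF assms(1)])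
  interpret S: dirichlet_weight "?b S" "ereal S"
    by (rule dirichlet_weight_bergman[OF assms(1) S(1)])
  have radial: "radial_weight (?b R)" if "R > 0" for R
    using dirichlet_weight_bergman[OF assms(1) that] by (simp add: dirichlet_weight_def)
  have B_le: "norm_coeff m (?b S) n \<le> norm_coeff m ?B n" for n
    using truncated_bergman_weight_le_bargmann[OF assms(1) S(1)]
    by (intro norm_coeff_mono moment_mono S.radial_weight_axioms B.radial_weight_axioms)
  have R_le: "norm_coeff m (?b S) n \<le> norm_coeff m (?b R) n" if "R \<ge> S" for n R
    using truncated_bergman_weight_mono[OF assms(1) S(1) that] that S(1)
    by (intro norm_coeff_mono moment_mono radial) auto
  have "((\<lambda>R. \<Sum>n. x ^ (2 * n) * \<bar>1 / norm_coeff m (?b R) n - 1 / norm_coeff m ?B n\<bar>) \<longlongrightarrow> (\<Sum>n. 0)) at_top"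
  proof (rule tannerys_theorem[THEN conjunct2, THEN conjunct2])
    show "summable (\<lambda>n. x ^ (2 * n) / norm_coeff m (?b S) n)"
      by (rule S.kernel_majorant_summable[OF assms(2) S(2)])
    fix n
    have "((\<lambda>R. norm_coeff m (?b R) n) \<longlongrightarrow> norm_coeff m ?B n) at_top"
      unfolding norm_coeff_def using moment_bergman_tendsto[OF assms(1)]
      by (cases "n < m") (auto intro!: tendsto_intros)
    then have "((\<lambda>R. x ^ (2 * n) * \<bar>1 / norm_coeff m (?b R) n - 1 / norm_coeff m ?B n\<bar>)
        \<longlongrightarrow> x ^ (2 * n) * \<bar>1 / norm_coeff m ?B n - 1 / norm_coeff m ?B n\<bar>) at_top"
      using B.norm_coeff_pos[of m n] by (intro tendsto_intros) auto
    then show "((\<lambda>R. x ^ (2 * n) * \<bar>1 / norm_coeff m (?b R) n - 1 / norm_coeff m ?B n\<bar>) \<longlongrightarrow> 0) at_top"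
      by simp
  next
    have "x ^ (2 * n) * \<bar>1 / norm_coeff m (?b R) n - 1 / norm_coeff m ?B n\<bar> \<le> x ^ (2 * n) / norm_coeff m (?b S) n"
      if "R \<ge> S" for n R
    proof -
      have "0 < norm_coeff m (?b S) n" "norm_coeff m (?b S) n \<le> norm_coeff m (?b R) n"
        "norm_coeff m (?b S) n \<le> norm_coeff m ?B n"
        using S.norm_coeff_pos R_le[OF that] B_le by auto
      then have "0 < 1 / norm_coeff m (?b R) n" "0 < 1 / norm_coeff m ?B n"
        "1 / norm_coeff m (?b R) n \<le> 1 / norm_coeff m (?b S) n" "1 / norm_coeff m ?B n \<le> 1 / norm_coeff m (?b S) n"
        by (auto simp: frac_le)
      then have "\<bar>1 / norm_coeff m (?b R) n - 1 / norm_coeff m ?B n\<bar> \<le> 1 / norm_coeff m (?b S) n"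
        by linarith
      from mult_left_mono[OF this, of "x ^ (2 * n)"] assms(2) show ?thesis
        by simp
    qed
    note majorant = this
    let ?P = "\<lambda>R. \<forall>n. norm (x ^ (2 * n) * \<bar>1 / norm_coeff m (?b R) n - 1 / norm_coeff m ?B n\<bar>)
        \<le> x ^ (2 * n) / norm_coeff m (?b S) n"
    have "eventually ?P at_top"
      using assms(2) majorant by (intro eventually_mono[OF eventually_ge_at_top[of S]]) (simp add: abs_mult)
    then show "\<forall>\<^sub>F (n, R) in sequentially \<times>\<^sub>F at_top.
        norm (x ^ (2 * n) * \<bar>1 / norm_coeff m (?b R) n - 1 / norm_coeff m ?B n\<bar>) \<le> x ^ (2 * n) / norm_coeff m (?b S) n"
      \<comment> \<open>The bound holds for all n as soon as R >= S, so the condition on n is the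
        trivial one.\<close>
      unfolding eventually_prod_filter by (intro exI[of _ "\<lambda>_. True"] exI[of _ ?P]) simp
  qed simp
  then show ?thesis
    by simp
qed

lemma kernel_uniform_limit:
  assumes "\<nu> > 0" "compact (C :: (complex \<times> complex) set)"
  shows "uniform_limit C (\<lambda>R (z, w). bergman_dirichlet_kernel (\<nu> * R\<^sup>2) m R z w)
           (\<lambda>(z, w). bargmann_dirichlet_kernel \<nu> m z w) at_top"
proof (rule uniform_limitI)
  fix e :: real assume "e > 0"
  \<comment> \<open>A norm bound for pairs bounds both components, so \<open>C\<close> lies in a
    closed bidisc of radius \<open>x\<close>; for R > x both kernels are given by their series
    there.\<close>
  obtain x where x: "x > 0" "\<And>p. p \<in> C \<Longrightarrow> norm p \<le> x"
    using compact_imp_bounded[OF assms(2)] unfolding bounded_pos by blast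
  have C: "cmod z \<le> x" "cmod w \<le> x" if "(z, w) \<in> C" for z w
    using x(2)[OF that] norm_fst_le[of z w] norm_snd_le[of w z] by auto
  let ?f = "\<lambda>R. \<Sum>n. x ^ (2 * n) * \<bar>1 / norm_coeff m (truncated_bergman_weight \<nu> R) n
            - 1 / norm_coeff m (bargmann_weight \<nu>) n\<bar>"
  have "\<forall>\<^sub>F R in at_top. ?f R < e"
    using kernel_majorant_tendsto_0[OF assms(1), of x m] x(1) \<open>e > 0\<close>
    by (intro order_tendstoD) auto
  then show "\<forall>\<^sub>F R in at_top. \<forall>p\<in>C. dist (case p of (z, w) \<Rightarrow> bergman_dirichlet_kernel (\<nu> * R\<^sup>2) m R z w)
      (case p of (z, w) \<Rightarrow> bargmann_dirichlet_kernel \<nu> m z w) < e"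
    using eventually_gt_at_top[of x]
  proof eventually_elim
    case (elim R)
    have R: "R > 0" "x < R"
      using elim(2) x(1) by auto
    have "dist (bergman_dirichlet_kernel (\<nu> * R\<^sup>2) m R z w) (bargmann_dirichlet_kernel \<nu> m z w) < e"
      if "(z, w) \<in> C" for z w
    proof -
      note zw = C[OF that]
      have "dist (bergman_dirichlet_kernel (\<nu> * R\<^sup>2) m R z w) (bargmann_dirichlet_kernel \<nu> m z w)
         = cmod (series_kernel m (truncated_bergman_weight \<nu> R) z w - series_kernel m (bargmann_weight \<nu>) z w)"
        using zw R assms(1)
        by (simp add: dist_norm bargmann_dirichlet_kernel_eq bergman_dirichlet_kernel_eq)
      also have "\<dots> \<le> ?f R"
        using zw R assms(1)
        by (intro series_kernel_diff_bound[OF dirichlet_weight_bergman dirichlet_weight_bargmann]) auto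
      also note elim(1)
      finally show ?thesis .
    qed
    then show ?case
      by auto
  qed
qed

theorem theorem1p5:
  fixes \<nu> :: real and m :: nat
  assumes "\<nu> > 0"
  shows "(\<forall>z w. ((\<lambda>R. bergman_dirichlet_kernel (\<nu> * R\<^sup>2) m R z w)
              \<longlongrightarrow> bargmann_dirichlet_kernel \<nu> m z w) at_top) \<and>
         (\<forall>C :: (complex \<times> complex) set. compact C \<longrightarrow>
            uniform_limit C
              (\<lambda>R (z, w). bergman_dirichlet_kernel (\<nu> * R\<^sup>2) m R z w)
              (\<lambda>(z, w). bargmann_dirichlet_kernel \<nu> m z w) at_top)"
proof (intro conjI allI impI)
  fix z w
  show "((\<lambda>R. bergman_dirichlet_kernel (\<nu> * R\<^sup>2) m R z w) \<longlongrightarrow> bargmann_dirichlet_kernel \<nu> m z w) at_top"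
    \<comment> \<open>A point is a compact set, so pointwise convergence is the singleton
      case.\<close>
    using tendsto_uniform_limitI[OF kernel_uniform_limit[OF assms, of "{(z, w)}"], of "(z, w)"] by simp
qed (rule kernel_uniform_limit[OF assms])

end
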